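(* Let $G$ be a connected, countably infinite graph of bounded degree, and consider Bernoulli (bond or site) percolation on $G$. Suppose that this model has the Aizenman–Newman–Barsky property (in particular, $G$ may be any vertex-transitive graph), and let $o\in V(G)$. Then the susceptibility $\chi(p)=\mathbb{E}_p(|C(o)|)$ is real-analytic in the interval $[0,p_c)$.
   Context: In Bernoulli bond (respectively site) percolation with parameter $p\in[0,1]$, each edge (respectively vertex) of $G$ is independently occupied with probability $p$ and vacant otherwise; the law is $\Pr_p$ with expectation $\mathbb{E}_p$. The cluster $C(o)$ is the connected component of $o$ in the subgraph spanned by the occupied edges (respectively induced by the occupied vertices), and $|C(o)|$ is its number of vertices. The critical value is $p_c:=\sup\{p : \Pr_p(|C(o)|=\infty)=0\}$, which does not depend on $o$. Aizenman–Newman–Barsky property: for every $p<p_c$ and every $o\in V(G)$ there is a constant $c=c(p,o)>0$ such that $\Pr_p(|C(o)|\ge n)\le e^{-cn}$ for all sufficiently large $n$. A function $f$ on an interval $I\subset\mathbb{R}$ is (real-)analytic on $I$ if every $x\in I$ is the centre of an open disc $D\subset\mathbb{C}$ on which there is a holomorphic function agreeing with $f$ on $D\cap I$. *)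

theory Defs
  imports "HOL-Probability.Probability" "HOL-Complex_Analysis.Complex_Analysis"
begin

section \<open>Graphs\<close>

definition simple_graph :: "'a set \<Rightarrow> 'a set set \<Rightarrow> bool" where
  "simple_graph V E \<longleftrightarrow> (\<forall>e\<in>E. \<exists>x\<in>V. \<exists>y\<in>V. x \<noteq> y \<and> e = {x, y})"

definition connected_graph :: "'a set \<Rightarrow> 'a set set \<Rightarrow> bool" where
  "connected_graph V E \<longleftrightarrow> (\<forall>x\<in>V. \<forall>y\<in>V. (x, y) \<in> {(a, b). {a, b} \<in> E}\<^sup>*)"

definition bounded_degree :: "'a set \<Rightarrow> 'a set set \<Rightarrow> bool" where
  "bounded_degree V E \<longleftrightarrow>
     (\<exists>d. \<forall>x\<in>V. finite {y. {x, y} \<in> E} \<and> card {y. {x, y} \<in> E} \<le> d)"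

definition graph_automorphism :: "'a set \<Rightarrow> 'a set set \<Rightarrow> ('a \<Rightarrow> 'a) \<Rightarrow> bool" where
  "graph_automorphism V E f \<longleftrightarrow>
     bij_betw f V V \<and> (\<forall>x\<in>V. \<forall>y\<in>V. {f x, f y} \<in> E \<longleftrightarrow> {x, y} \<in> E)"

definition vertex_transitive :: "'a set \<Rightarrow> 'a set set \<Rightarrow> bool" where
  "vertex_transitive V E \<longleftrightarrow>
     (\<forall>x\<in>V. \<forall>y\<in>V. \<exists>f. graph_automorphism V E f \<and> f x = y)"

section \<open>Bernoulli percolation\<close>

text \<open>
  A percolation model is given by the set \<open>I\<close> of items that are occupied or vacant and by the map
  \<open>C\<close> that sends a vertex and a configuration to the cluster of that vertex. Bond percolation
  is \<open>I = E\<close>, \<open>C = bond_cluster E\<close>; site percolation is \<open>I = V\<close>, \<open>C = site_cluster E\<close>.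
\<close>

definition percolation_law :: "'i set \<Rightarrow> real \<Rightarrow> ('i \<Rightarrow> bool) measure" where
  "percolation_law I p = PiM I (\<lambda>_. measure_pmf (bernoulli_pmf p))"

definition bond_cluster :: "'a set set \<Rightarrow> 'a \<Rightarrow> ('a set \<Rightarrow> bool) \<Rightarrow> 'a set" where
  "bond_cluster E v \<omega> = {w. (v, w) \<in> {(x, y). {x, y} \<in> E \<and> \<omega> {x, y}}\<^sup>*}"

text \<open>The cluster of a vacant vertex in site percolation is empty.\<close>

definition site_cluster :: "'a set set \<Rightarrow> 'a \<Rightarrow> ('a \<Rightarrow> bool) \<Rightarrow> 'a set" where
  "site_cluster E v \<omega> = {w. \<omega> v \<and> (v, w) \<in> {(x, y). {x, y} \<in> E \<and> \<omega> x \<and> \<omega> y}\<^sup>*}"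

definition set_size :: "'a set \<Rightarrow> enat" where
  "set_size A = (if finite A then enat (card A) else \<infinity>)"

definition critical_value :: "'i set \<Rightarrow> ('a \<Rightarrow> ('i \<Rightarrow> bool) \<Rightarrow> 'a set) \<Rightarrow> 'a \<Rightarrow> real" where
  "critical_value I C v =
     Sup {p \<in> {0..1}. measure (percolation_law I p)
            {\<omega> \<in> space (percolation_law I p). set_size (C v \<omega>) = \<infinity>} = 0}"

text \<open>
  On a connected graph \<open>critical_value\<close> does not depend on the vertex, so evaluating it at the
  vertex under consideration is immaterial.
\<close>

definition ANB_property :: "'a set \<Rightarrow> 'i set \<Rightarrow> ('a \<Rightarrow> ('i \<Rightarrow> bool) \<Rightarrow> 'a set) \<Rightarrow> bool" where
  "ANB_property V I C \<longleftrightarrow>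
     (\<forall>v\<in>V. \<forall>p. 0 \<le> p \<and> p < critical_value I C v \<longrightarrow>
       (\<exists>c>0. eventually (\<lambda>n. measure (percolation_law I p)
            {\<omega> \<in> space (percolation_law I p). set_size (C v \<omega>) \<ge> enat n}
              \<le> exp (- (c * real n))) sequentially))"

definition susceptibility ::
    "'i set \<Rightarrow> ('a \<Rightarrow> ('i \<Rightarrow> bool) \<Rightarrow> 'a set) \<Rightarrow> 'a \<Rightarrow> real \<Rightarrow> ennreal" where
  "susceptibility I C v p =
     (\<integral>\<^sup>+ \<omega>. ennreal_of_enat (set_size (C v \<omega>)) \<partial>percolation_law I p)"

section \<open>Real-analyticity\<close>

definition real_analytic_on :: "(real \<Rightarrow> real) \<Rightarrow> real set \<Rightarrow> bool" where
  "real_analytic_on f I \<longleftrightarrow>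
     (\<forall>x\<in>I. \<exists>r>0. \<exists>g. g holomorphic_on ball (complex_of_real x) r \<and>
        (\<forall>y\<in>I. complex_of_real y \<in> ball (complex_of_real x) r \<longrightarrow>
           g (complex_of_real y) = complex_of_real (f y)))"

text \<open>
  For a function with values in \<open>[0, \<infinity>]\<close> finiteness is required separately, because
  \<open>enn2real\<close> sends \<open>\<infinity>\<close> to \<open>0\<close>.
\<close>

definition ennreal_analytic_on :: "(real \<Rightarrow> ennreal) \<Rightarrow> real set \<Rightarrow> bool" where
  "ennreal_analytic_on f I \<longleftrightarrow>
     (\<forall>x\<in>I. f x < \<infinity>) \<and> real_analytic_on (\<lambda>x. enn2real (f x)) I"

end

theory Submission imports Defs begin

text \<open>
  Analyticity: expand the susceptibility as the sum of \<open>|A| * P(C = A)\<close> over finite sets \<open>A\<close>.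
  The event \<open>C = A\<close> depends on at most \<open>d * |A|\<close> items, so its probability is a polynomial, and for
  complex \<open>z\<close> near \<open>x\<close> its modulus is at most \<open>M^(d * |A|)\<close> times its value at a real \<open>p\<close> slightly
  above \<open>x\<close>, with \<open>M\<close> close to \<open>1\<close>. The exponential decay of the cluster size absorbs the factor,
  so the series of polynomials converges locally uniformly.

  Sharpness for vertex-transitive graphs follows Duminil-Copin and Tassion. For a finite set \<open>S\<close>
  around \<open>o\<close> let \<open>Z\<close> be the set of vertices outside \<open>S\<close> adjacent to the cluster of \<open>o\<close> in \<open>S\<close>. If
  \<open>E|Z| \<ge> 1\<close> for all \<open>S\<close> and all parameters in \<open>(p, q)\<close>, then Russo's formula gives
  \<open>\<theta>' \<ge> 1 - \<theta>\<close> for the probability \<open>\<theta>\<close> of leaving a finite set, hence percolation at \<open>q\<close>.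
  If \<open>E|Z| < 1\<close> for some \<open>S\<close>, exploring the cluster in steps of translates of \<open>S\<close> compares it with
  a subcritical branching process, and so some exponential moment of the cluster size is finite.
\<close>

section \<open>Expectations under finite product Bernoulli measures\<close>

text \<open>The sharpness argument is carried out on \<open>bexp\<close>, a finite sum over
  configurations of finitely many items, and passes to the product measure by monotone limits of
  events. The sum makes sense in any commutative ring: at real \<open>p\<close> it is an
  expectation, at complex \<open>z\<close> a polynomial.

  On the disc of radius \<delta> about x the comparison point is p = x + \<delta>. There |z| \<le>
  p, so open items cost nothing, and |1 - z| \<le> 1 - x + \<delta> = M (1 - p) with M = (1 - x +
  \<delta>) / (1 - x - \<delta>), so each closed item costs at most M. There is no division by x, so
  the endpoint x = 0 is covered too.

  \<open>Z\<close> contains the vertices behind closed items as well. It therefore depends only on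
  items inside \<open>S\<close>, and the same count bounds the number of pivotal items from below
  and the number of new starting points of the exploration from above. Vertices are counted instead
  of arcs because in site percolation all arcs into one vertex share one item.\<close>

definition bexp :: "'i set \<Rightarrow> 'b::comm_ring_1 \<Rightarrow> ('i set \<Rightarrow> 'b) \<Rightarrow> 'b" where
  "bexp J p f = (\<Sum>B\<in>Pow J. p ^ card B * (1 - p) ^ card (J - B) * f B)"

lemma bexp_cong: "(\<And>B. B \<subseteq> J \<Longrightarrow> f B = g B) \<Longrightarrow> bexp J p f = bexp J p g"
  unfolding bexp_def by (intro sum.cong) auto

lemma bexp_empty [simp]: "bexp {} p f = f {}"
  by (simp add: bexp_def)

text \<open>Conditioning on the state of \<open>i\<close>; the step of the inductions over
  \<open>J\<close>.\<close>

lemma bexp_insert: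
  assumes "finite J" "i \<notin> J"
  shows "bexp (insert i J) p f = p * bexp J p (\<lambda>B. f (insert i B)) + (1 - p) * bexp J p f"
proof -
  have inj: "inj_on (insert i) (Pow J)"
    using assms(2) by (auto simp: inj_on_def insert_ident)
  have disj: "Pow J \<inter> insert i ` Pow J = {}"
    using assms(2) by auto
  have 1: "(\<Sum>B\<in>Pow J. p ^ card B * (1 - p) ^ card (insert i J - B) * f B) = (1 - p) * bexp J p f"
    unfolding bexp_def sum_distrib_left
  proof (intro sum.cong refl)
    fix B assume "B \<in> Pow J"
    then have "insert i J - B = insert i (J - B)" "i \<notin> J - B" "finite (J - B)"
      using assms by auto
    then show "p ^ card B * (1 - p) ^ card (insert i J - B) * f B
        = (1 - p) * (p ^ card B * (1 - p) ^ card (J - B) * f B)"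
      by (simp add: algebra_simps)
  qed
  have 2: "(\<Sum>B\<in>Pow J. p ^ card (insert i B) * (1 - p) ^ card (insert i J - insert i B) * f (insert i B))
      = p * bexp J p (\<lambda>B. f (insert i B))"
    unfolding bexp_def sum_distrib_left
  proof (intro sum.cong refl)
    fix B assume "B \<in> Pow J"
    then have "insert i J - insert i B = J - B" "i \<notin> B" "finite B"
      using assms finite_subset by auto
    then show "p ^ card (insert i B) * (1 - p) ^ card (insert i J - insert i B) * f (insert i B)
        = p * (p ^ card B * (1 - p) ^ card (J - B) * f (insert i B))"
      by (simp add: algebra_simps)
  qed
  have "bexp (insert i J) p f = (\<Sum>B\<in>Pow J. p ^ card B * (1 - p) ^ card (insert i J - B) * f B)
      + (\<Sum>B\<in>insert i ` Pow J. p ^ card B * (1 - p) ^ card (insert i J - B) * f B)"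
    unfolding bexp_def[of "insert i J"] Pow_insert
    using assms disj by (intro sum.union_disjoint) auto
  then show ?thesis
    unfolding sum.reindex[OF inj] o_def 1 2 by (simp only: add.commute)
qed

lemma bexp_diff: "bexp J p (\<lambda>B. f B - g B) = bexp J p f - bexp J p g"
  by (simp add: bexp_def sum_subtractf algebra_simps)

lemma bexp_cmult: "bexp J p (\<lambda>B. c * f B) = c * bexp J p f"
  by (simp add: bexp_def sum_distrib_left algebra_simps)

lemma bexp_sum: "bexp J p (\<lambda>B. \<Sum>a\<in>A. f a B) = (\<Sum>a\<in>A. bexp J p (f a))"
  unfolding bexp_def sum_distrib_left by (rule sum.swap)

lemma bexp_const: "finite J \<Longrightarrow> bexp J p (\<lambda>_. c) = c"
  by (induction J rule: finite_induct) (auto simp: bexp_insert algebra_simps)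

lemma bexp_mono:
  fixes p :: real
  assumes "0 \<le> p" "p \<le> 1" "\<And>B. B \<subseteq> J \<Longrightarrow> f B \<le> g B"
  shows "bexp J p f \<le> bexp J p g"
  unfolding bexp_def using assms by (intro sum_mono mult_left_mono) auto

lemma bexp_Un:
  assumes "finite J" "finite K" "J \<inter> K = {}"
  shows "bexp (J \<union> K) p f = bexp J p (\<lambda>B. bexp K p (\<lambda>B'. f (B \<union> B')))"
  using assms(1,3)
proof (induction J arbitrary: f rule: finite_induct)
  case (insert i J)
  then show ?case
    using assms(2) by (simp add: bexp_insert)
qed simp

lemma bexp_split:
  assumes "finite J"
  shows "bexp J p f = bexp (J \<inter> K) p (\<lambda>B. bexp (J - K) p (\<lambda>B'. f (B \<union> B')))"
proof -
  have "J = (J \<inter> K) \<union> (J - K)" by auto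
  then show ?thesis using bexp_Un[of "J \<inter> K" "J - K" p f] assms by auto
qed

text \<open>The hypothesis on \<open>f\<close> says that it looks only at items of \<open>K\<close>.
  The remaining items integrate out, since the weights of their states sum to 1.\<close>

lemma bexp_restrict:
  assumes "finite J" "\<And>B. f (B \<inter> K) = f B"
  shows "bexp J p f = bexp (J \<inter> K) p f"
proof -
  have "f (B \<union> B') = f B" if "B \<subseteq> J \<inter> K" "B' \<subseteq> J - K" for B B'
  proof -
    have "(B \<union> B') \<inter> K = B" using that by auto
    then show ?thesis using assms(2)[of "B \<union> B'"] by simp
  qed
  then have "bexp (J - K) p (\<lambda>B'. f (B \<union> B')) = f B" if "B \<subseteq> J \<inter> K" for B
    using bexp_cong[of "J - K" "\<lambda>B'. f (B \<union> B')" "\<lambda>_. f B" p] that assms(1)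
    by (simp add: bexp_const)
  then show ?thesis
    by (subst bexp_split[of J p f K]) (auto intro: bexp_cong assms(1))
qed

text \<open>The invariance hypotheses say that \<open>f\<close> looks only at \<open>K\<close> and
  \<open>g\<close> only outside it. After \<open>bexp_split\<close> the inner expectation concerns
  \<open>g\<close> alone, so the product factorises.\<close>

lemma bexp_indep:
  assumes "finite J" "\<And>B. f (B \<inter> K) = f B" "\<And>B. g (B - K) = g B"
  shows "bexp J p (\<lambda>B. f B * g B) = bexp J p f * bexp J p g"
proof -
  have f: "f (B \<union> B') = f B" if "B \<subseteq> J \<inter> K" "B' \<subseteq> J - K" for B B'
  proof -
    have "(B \<union> B') \<inter> K = B" using that by auto
    then show ?thesis using assms(2)[of "B \<union> B'"] by simp
  qed
  have g: "g (B \<union> B') = g B'" if "B \<subseteq> J \<inter> K" "B' \<subseteq> J - K" for B B'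
  proof -
    have "(B \<union> B') - K = B'" using that by auto
    then show ?thesis using assms(3)[of "B \<union> B'"] by simp
  qed
  have "bexp J p (\<lambda>B. f B * g B)
      = bexp (J \<inter> K) p (\<lambda>B. bexp (J - K) p (\<lambda>B'. f (B \<union> B') * g (B \<union> B')))"
    by (rule bexp_split[OF assms(1)])
  also have "\<dots> = bexp (J \<inter> K) p (\<lambda>B. bexp (J - K) p (\<lambda>B'. f B * g B'))"
    using f g by (intro bexp_cong) auto
  also have "\<dots> = bexp (J \<inter> K) p (\<lambda>B. bexp (J - K) p g * f B)"
    by (simp only: bexp_cmult mult.commute)
  also have "\<dots> = bexp (J \<inter> K) p f * bexp (J - K) p g"
    by (simp only: bexp_cmult mult.commute[of "bexp (J \<inter> K) p f"])
  also have "bexp (J \<inter> K) p f = bexp J p f"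
    using bexp_restrict[of J f K p] assms(1,2) by simp
  also have "bexp (J - K) p g = bexp J p g"
    using bexp_restrict[of J g "- K" p] assms(1,3) by (simp add: Diff_eq)
  finally show ?thesis .
qed

lemma bexp_image:
  assumes "inj_on h J"
  shows "bexp (h ` J) p f = bexp J p (\<lambda>B. f (h ` B))"
proof -
  have inj: "inj_on ((`) h) (Pow J)"
    using assms by (simp add: inj_on_image_Pow)
  have "card (h ` B) = card B \<and> card (h ` J - h ` B) = card (J - B)" if "B \<subseteq> J" for B
    using that assms by (metis Diff_subset card_image inj_on_image_set_diff inj_on_subset)
  then show ?thesis
    unfolding bexp_def image_Pow_surj[symmetric, OF refl] sum.reindex[OF inj]
    by (intro sum.cong) auto
qed

lemma bexp_mono_set:
  fixes p :: real
  assumes "0 \<le> p" "p \<le> 1" "finite K" "J \<subseteq> K" "mono f"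
  shows "bexp J p f \<le> bexp K p f"
proof -
  have fin: "finite J" "K \<inter> J = J" using assms finite_subset by auto
  have "bexp J p f = bexp J p (\<lambda>B. bexp (K - J) p (\<lambda>_. f B))"
    using assms(3) by (simp add: bexp_const)
  also have "\<dots> \<le> bexp J p (\<lambda>B. bexp (K - J) p (\<lambda>B'. f (B \<union> B')))"
    using assms(1,2) monoD[OF assms(5)] by (intro bexp_mono) auto
  also have "\<dots> = bexp K p f"
    using bexp_split[OF assms(3), of p f J] fin(2) by simp
  finally show ?thesis .
qed

text \<open>Induction on the items takes the place of a monotone coupling: raising the parameter of
  one item moves weight \<open>q - p\<close> from the closed to the open state.\<close>

lemma bexp_mono_param:
  fixes p q :: real
  assumes "0 \<le> p" "p \<le> q" "q \<le> 1" "finite J" "mono f"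
  shows "bexp J p f \<le> bexp J q f"
  using assms(4,5)
proof (induction J arbitrary: f rule: finite_induct)
  case (insert i J)
  let ?g = "\<lambda>B. f (insert i B)"
  have m: "mono ?g"
    by (auto intro!: monoI monoD[OF insert.prems])
  have le: "bexp J q f \<le> bexp J q ?g"
    using insert.prems assms by (intro bexp_mono) (auto dest: monoD)
  have "bexp (insert i J) p f = p * bexp J p ?g + (1 - p) * bexp J p f"
    using insert.hyps by (rule bexp_insert)
  also have "\<dots> \<le> p * bexp J q ?g + (1 - p) * bexp J q f"
    using insert.IH[OF m] insert.IH[OF insert.prems] assms by (intro add_mono mult_left_mono) auto
  also have "\<dots> \<le> q * bexp J q ?g + (1 - q) * bexp J q f"
    using mult_nonneg_nonneg[of "q - p" "bexp J q ?g - bexp J q f"] le assms by (simp add: algebra_simps)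
  also have "\<dots> = bexp (insert i J) q f"
    using insert.hyps by (simp add: bexp_insert)
  finally show ?case .
qed simp

text \<open>Differentiating \<open>bexp_insert\<close> gives the influence of the new item plus the
  convex combination of two derivatives known by induction. For the indicator of an increasing event
  each summand is the probability that \<open>i\<close> is pivotal.\<close>

lemma russo_formula:
  fixes p :: real
  assumes "finite J"
  shows "((\<lambda>p. bexp J p f) has_real_derivative
    (\<Sum>i\<in>J. bexp J p (\<lambda>B. f (insert i B) - f (B - {i})))) (at p)"
  using assms
proof (induction J arbitrary: f rule: finite_induct)
  case (insert j J)
  let ?g = "\<lambda>B. f (insert j B)"
  let ?D = "\<lambda>f. \<Sum>i\<in>J. bexp J p (\<lambda>B. f (insert i B) - f (B - {i}))"
  let ?\<Delta> = "\<lambda>i B. f (insert i B) - f (B - {i})"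
  have "((\<lambda>p. p * bexp J p ?g + (1 - p) * bexp J p f) has_real_derivative
      bexp J p ?g - bexp J p f + (p * ?D ?g + (1 - p) * ?D f)) (at p)"
    by (rule derivative_eq_intros insert.IH refl | simp)+
  moreover have "bexp (insert j J) p (?\<Delta> j) = bexp J p ?g - bexp J p f"
  proof -
    have "bexp J p (?\<Delta> j) = bexp J p (\<lambda>B. ?g B - f B)"
      using insert.hyps by (intro bexp_cong) (metis Diff_empty Diff_insert0 subsetD)
    moreover have "bexp J p (\<lambda>B. ?\<Delta> j (insert j B)) = bexp J p (\<lambda>B. ?g B - f B)"
      using insert.hyps
      by (intro bexp_cong) (metis Diff_insert_absorb insert_absorb2 subsetD)
    ultimately show ?thesis
      using insert.hyps by (simp add: bexp_insert bexp_diff algebra_simps)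
  qed
  moreover have "(\<Sum>i\<in>J. bexp (insert j J) p (?\<Delta> i)) = p * ?D ?g + (1 - p) * ?D f"
    unfolding sum_distrib_left sum.distrib[symmetric]
  proof (intro sum.cong refl)
    fix i assume "i \<in> J"
    then have "i \<noteq> j" using insert.hyps by auto
    then show "bexp (insert j J) p (?\<Delta> i) = p * bexp J p (\<lambda>B. ?g (insert i B) - ?g (B - {i}))
        + (1 - p) * bexp J p (?\<Delta> i)"
      using insert.hyps by (simp add: bexp_insert insert_commute insert_Diff_if)
  qed
  ultimately show ?case
    unfolding sum.insert[OF insert.hyps] bexp_insert[OF insert.hyps, of _ f] by simp
qed simp

section \<open>Directed exploration of clusters\<close>

text \<open>
  The arc from \<open>x\<close> to \<open>y\<close> is open iff the item \<open>r x y\<close> is. Bond percolation is \<open>r x y = {x, y}\<close> and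
  site percolation is \<open>r x y = y\<close>: the state of the start of a path is never consulted.
\<close>

locale item_graph =
  fixes V :: "'a set" and E :: "'a set set" and I :: "'i set" and r :: "'a \<Rightarrow> 'a \<Rightarrow> 'i"
  assumes simple: "simple_graph V E"
    and countable_V: "countable V"
    and bounded: "bounded_degree V E"
    and item_in: "{x, y} \<in> E \<Longrightarrow> r x y \<in> I"
    and item_head: "{x, y} \<in> E \<Longrightarrow> {x', y'} \<in> E \<Longrightarrow> r x y = r x' y' \<Longrightarrow> y \<in> {x', y'}"
begin

section \<open>Reachability, clusters inside a set, and their exits\<close>

definition arcs :: "'i set \<Rightarrow> ('a \<times> 'a) set" where
  "arcs B = {(x, y). {x, y} \<in> E \<and> r x y \<in> B}"

definition reach :: "'i set \<Rightarrow> 'a set \<Rightarrow> 'a set" where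
  "reach B A = (arcs B)\<^sup>* `` A"

definition reach_in :: "'a set \<Rightarrow> 'i set \<Rightarrow> 'a \<Rightarrow> 'a set" where
  "reach_in S B y = (arcs B \<inter> S \<times> S)\<^sup>* `` {y}"

definition bdry :: "'a set \<Rightarrow> 'i set \<Rightarrow> 'a \<Rightarrow> 'a set" where
  "bdry S B y = {z. z \<notin> S \<and> (\<exists>x\<in>reach_in S B y. {x, z} \<in> E)}"

definition inner_items :: "'a set \<Rightarrow> 'i set" where
  "inner_items S = {r x y |x y. x \<in> S \<and> y \<in> S \<and> {x, y} \<in> E}"

text \<open>The items to be examined in order to know that an exploration stops at \<open>S\<close>:
  the edges touching \<open>S\<close> for bonds, the neighbours of vertices of \<open>S\<close> for
  sites.\<close>

definition out_items :: "'a set \<Rightarrow> 'i set" where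
  "out_items S = {r x y |x y. x \<in> S \<and> {x, y} \<in> E}"

lemma edge_V: "{x, y} \<in> E \<Longrightarrow> x \<in> V \<and> y \<in> V"
  using simple unfolding simple_graph_def by (metis doubleton_eq_iff)

lemma finite_nbrs: "finite {y. {x, y} \<in> E}"
proof (cases "x \<in> V")
  case True
  then show ?thesis using bounded unfolding bounded_degree_def by auto
next
  case False
  then have "{y. {x, y} \<in> E} = {}" using edge_V by auto
  then show ?thesis by simp
qed

lemma finite_out_items: "finite S \<Longrightarrow> finite (out_items S)"
proof -
  assume "finite S"
  have "out_items S = (\<Union>x\<in>S. r x ` {y. {x, y} \<in> E})"
    by (auto simp: out_items_def)
  then show ?thesis using \<open>finite S\<close> finite_nbrs by simp
qed

lemma inner_subset_out: "inner_items S \<subseteq> out_items S"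
  by (auto simp: inner_items_def out_items_def)

lemma finite_inner_items: "finite S \<Longrightarrow> finite (inner_items S)"
  using finite_out_items inner_subset_out finite_subset by metis

lemma out_items_subset: "out_items S \<subseteq> I"
  using item_in by (auto simp: out_items_def)

text \<open>By \<open>item_head\<close> the head \<open>z\<close> would be an endpoint of an arc
  inside \<open>S\<close>. So the items across the boundary have no influence on
  \<open>reach_in S\<close>.\<close>

lemma boundary_item_not_inner: "{x, z} \<in> E \<Longrightarrow> z \<notin> S \<Longrightarrow> r x z \<notin> inner_items S"
proof
  assume xz: "{x, z} \<in> E" "z \<notin> S" and "r x z \<in> inner_items S"
  then obtain x' y' where "x' \<in> S" "y' \<in> S" "{x', y'} \<in> E" "r x z = r x' y'"
    by (auto simp: inner_items_def)
  then show False using item_head[of x z x' y'] xz by auto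
qed

lemma arcs_mono: "B \<subseteq> B' \<Longrightarrow> arcs B \<subseteq> arcs B'"
  by (auto simp: arcs_def)

lemma reach_mono: "B \<subseteq> B' \<Longrightarrow> reach B A \<subseteq> reach B' A"
  unfolding reach_def using rtrancl_mono[OF arcs_mono] by blast

lemma reach_in_mono: "B \<subseteq> B' \<Longrightarrow> reach_in S B y \<subseteq> reach_in S B' y"
  unfolding reach_in_def using rtrancl_mono[of "arcs B \<inter> S \<times> S" "arcs B' \<inter> S \<times> S"] arcs_mono by blast

lemma bdry_mono: "B \<subseteq> B' \<Longrightarrow> bdry S B y \<subseteq> bdry S B' y"
  using reach_in_mono[of B B' S y] unfolding bdry_def by blast

lemma reach_subset_V: "A \<subseteq> V \<Longrightarrow> reach B A \<subseteq> V"
proof -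
  assume A: "A \<subseteq> V"
  have "w \<in> V" if "(a, w) \<in> (arcs B)\<^sup>*" "a \<in> V" for a w
    using that by (induction) (auto simp: arcs_def dest: edge_V)
  then show ?thesis using A by (auto simp: reach_def)
qed

lemma reach_in_subset: "y \<in> S \<Longrightarrow> reach_in S B y \<subseteq> S"
proof -
  assume y: "y \<in> S"
  have "w \<in> S" if "(y, w) \<in> (arcs B \<inter> S \<times> S)\<^sup>*" for w
    using that y by (induction) auto
  then show ?thesis by (auto simp: reach_in_def)
qed

lemma reach_in_self: "y \<in> reach_in S B y"
  by (simp add: reach_in_def)

lemma reach_in_step:
  "x \<in> reach_in S B y \<Longrightarrow> y \<in> S \<Longrightarrow> {x, z} \<in> E \<Longrightarrow> r x z \<in> B \<Longrightarrow> z \<in> S \<Longrightarrow> z \<in> reach_in S B y"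
proof -
  assume x: "x \<in> reach_in S B y" and "y \<in> S" "{x, z} \<in> E" "r x z \<in> B" "z \<in> S"
  then have "(x, z) \<in> arcs B \<inter> S \<times> S"
    using reach_in_subset[of y S B] by (auto simp: arcs_def)
  with x show ?thesis
    unfolding reach_in_def Image_singleton mem_Collect_eq by (rule rtrancl_into_rtrancl)
qed

lemma reach_step: "x \<in> reach B A \<Longrightarrow> (x, z) \<in> arcs B \<Longrightarrow> z \<in> reach B A"
  unfolding reach_def by (meson Image_iff rtrancl_into_rtrancl)

lemma reach_in_local: "reach_in S (B \<inter> inner_items S) y = reach_in S B y"
proof -
  have "arcs (B \<inter> inner_items S) \<inter> S \<times> S = arcs B \<inter> S \<times> S"
    by (auto simp: arcs_def inner_items_def)
  then show ?thesis by (simp add: reach_in_def)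
qed

lemma bdry_local: "bdry S (B \<inter> inner_items S) y = bdry S B y"
  by (simp add: bdry_def reach_in_local)

lemma finite_bdry: "finite S \<Longrightarrow> y \<in> S \<Longrightarrow> finite (bdry S B y)"
proof -
  assume "finite S" "y \<in> S"
  then have "bdry S B y \<subseteq> (\<Union>x\<in>S. {z. {x, z} \<in> E})"
    using reach_in_subset[of y S B] unfolding bdry_def by blast
  then show ?thesis using \<open>finite S\<close> finite_nbrs by (auto intro: finite_subset)
qed

text \<open>By \<open>item_head\<close> an item is the label of arcs into at most two vertices.\<close>

lemma finite_reach:
  assumes "finite B" "finite A"
  shows "finite (reach B A)"
proof -
  define H where "H i = {y. \<exists>x. {x, y} \<in> E \<and> r x y = i}" for i
  have "finite (H i)" for i
  proof (cases "H i = {}")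
    case False
    then obtain x y where "{x, y} \<in> E" "r x y = i" by (auto simp: H_def)
    then have "H i \<subseteq> {x, y}" using item_head[of _ _ x y] by (auto simp: H_def)
    then show ?thesis using finite_subset by blast
  qed simp
  moreover have "w \<in> A \<union> (\<Union>i\<in>B. H i)" if "(a, w) \<in> (arcs B)\<^sup>*" "a \<in> A" for a w
    using that by (cases rule: rtranclE) (auto simp: H_def arcs_def)
  then have "reach B A \<subseteq> A \<union> (\<Union>i\<in>B. H i)"
    unfolding reach_def by blast
  ultimately show ?thesis
    using assms by (meson finite_UN_I finite_UnI finite_subset)
qed

text \<open>
  \<open>Z\<close> collects the exits through all items of \<open>J\<close>, open or not. Restricting to \<open>J\<close> makes the induction
  below well-founded: if no item of \<open>J\<close> leaves \<open>D\<close>, then \<open>Z = {}\<close> and the set of sources shrinks.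
\<close>

lemma reach_decomp:
  assumes "y \<in> A" "y \<in> S" and D: "D = reach_in S B y" and "B \<subseteq> J"
    and Z: "Z = {z. z \<notin> S \<and> (\<exists>x\<in>D. {x, z} \<in> E \<and> r x z \<in> J)}"
  shows "reach B A \<subseteq> D \<union> reach (B - out_items D) (A - {y} \<union> Z)"
proof
  fix w assume "w \<in> reach B A"
  then obtain a where a: "a \<in> A" "(a, w) \<in> (arcs B)\<^sup>*" by (auto simp: reach_def)
  let ?R = "reach (B - out_items D) (A - {y} \<union> Z)"
  have start: "A - {y} \<union> Z \<subseteq> ?R" by (auto simp: reach_def)
  have leave: "z \<in> D \<union> ?R" if "x \<in> D" "{x, z} \<in> E" "r x z \<in> B" for x z
  proof (cases "z \<in> S")
    case True
    then show ?thesis using that assms(2) reach_in_step D by auto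
  next
    case False
    then have "z \<in> Z" using that Z \<open>B \<subseteq> J\<close> by auto
    then show ?thesis using start by auto
  qed
  show "w \<in> D \<union> ?R"
    using a(2)
  proof (induction)
    case base
    then show ?case using a(1) reach_in_self[of y S B] D start by auto
  next
    case (step w w')
    then have e: "{w, w'} \<in> E" "r w w' \<in> B" by (auto simp: arcs_def)
    show ?case
    proof (cases "w \<in> D")
      case True
      then show ?thesis using leave e by blast
    next
      case False
      then have w: "w \<in> ?R" using step.IH by blast
      show ?thesis
      \<comment> \<open>The arc starts outside \<open>D\<close>, yet its item may have been examined
        from inside. By \<open>item_head\<close> its head is then an endpoint of an examined arc
        from \<open>x\<close> to \<open>z\<close>: \<open>x\<close> lies in \<open>D\<close>, and
        \<open>z\<close> is covered by \<open>leave\<close> because the shared item is open.\<close>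
      proof (cases "r w w' \<in> out_items D")
        case True
        then obtain x z where xz: "x \<in> D" "{x, z} \<in> E" "r w w' = r x z"
          by (auto simp: out_items_def)
        then have "w' = x \<or> w' = z" using item_head[of w w' x z] e by blast
        moreover have "z \<in> D \<union> ?R" using leave[of x z] xz e(2) by metis
        ultimately show ?thesis using xz by auto
      next
        case False
        then have "(w, w') \<in> arcs (B - out_items D)" using e by (auto simp: arcs_def)
        then show ?thesis using w by (auto simp: reach_def intro: rtrancl_into_rtrancl)
      qed
    qed
  qed
qed

text \<open>Exploring from \<open>y\<close> and finding exactly \<open>d\<close> consults only the
  items of arcs that start in \<open>d\<close>.\<close>

lemma reach_in_determined:
  assumes "y \<in> S"
  shows "reach_in S (B \<inter> out_items d) y = d \<longleftrightarrow> reach_in S B y = d"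
proof -
  have *: "reach_in S B' y = d"
    if d: "reach_in S B y = d" and BQ: "B \<inter> out_items d = B' \<inter> out_items d" for B B'
  proof -
    have items: "r w w' \<in> B \<longleftrightarrow> r w w' \<in> B'" if "w \<in> d" "{w, w'} \<in> E" for w w'
    proof -
      have "r w w' \<in> out_items d" using that by (auto simp: out_items_def)
      then show ?thesis using BQ by blast
    qed
    have yd: "y \<in> d" "y \<in> reach_in S B' y" using d reach_in_self by auto
    have 1: "w \<in> d" if "(y, w) \<in> (arcs B' \<inter> S \<times> S)\<^sup>*" for w
      using that
    proof (induction)
      case (step w w')
      then have e: "{w, w'} \<in> E" "r w w' \<in> B'" "w' \<in> S" by (auto simp: arcs_def)
      then have "r w w' \<in> B" using items step.IH by blast
      then show ?case using reach_in_step[of w S B y w'] e step.IH d assms(1) by blast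
    qed (rule yd)
    have 2: "w \<in> d \<and> w \<in> reach_in S B' y" if "(y, w) \<in> (arcs B \<inter> S \<times> S)\<^sup>*" for w
      using that
    proof (induction)
      case (step w w')
      then have e: "{w, w'} \<in> E" "r w w' \<in> B" "w' \<in> S" by (auto simp: arcs_def)
      then have "r w w' \<in> B'" using items step.IH by blast
      then show ?case
        using reach_in_step[of w S B y w'] reach_in_step[of w S B' y w'] e step.IH d assms(1) by blast
    qed (use yd in blast)
    show ?thesis
      using 1 2 d by (auto simp: reach_in_def)
  qed
  show ?thesis
    using *[of "B \<inter> out_items d" B] *[of B "B \<inter> out_items d"] by (metis inf.right_idem)
qed

text \<open>A supermartingale argument. Each pending vertex carries the weight \<open>K\<close>.
  Exploring \<open>S y\<close> around a pending \<open>y\<close> costs at most the factor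
  \<open>T ^ card (S y)\<close> and replaces \<open>y\<close> by exits; by \<open>step\<close> this
  does not raise the total weight on average. Examined items are removed from \<open>J\<close>, so
  the remaining ones are fresh.\<close>

lemma bexp_reach_moment:
  fixes p T K :: real
  assumes p: "0 \<le> p" "p \<le> 1" and T: "1 \<le> T" and K: "1 \<le> K"
    and S: "\<And>y. y \<in> V \<Longrightarrow> finite (S y) \<and> y \<in> S y"
    and step: "\<And>y J. y \<in> V \<Longrightarrow> finite J \<Longrightarrow>
      T ^ card (S y) * bexp J p (\<lambda>B. K ^ card (bdry (S y) B y)) \<le> K"
    and "finite J" "finite A" "A \<subseteq> V"
  shows "bexp J p (\<lambda>B. T ^ card (reach B A)) \<le> K ^ card A"
  using assms(7-9)
proof (induction "(J, A)" arbitrary: J A rule: wf_induct_rule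
      [OF wf_measures[of "[\<lambda>x. card (fst x), \<lambda>x. card (snd x)]"]])
  case (1 J A)
  note fin = 1(2,3) and AV = 1(4)
  show ?case
  proof (cases "A = {}")
    case True
    then show ?thesis by (simp add: reach_def bexp_const fin)
  next
    case False
    then obtain y where y: "y \<in> A" by auto
    then have yV: "y \<in> V" using AV by auto
    define s where "s = S y"
    have s: "finite s" "y \<in> s" using S[OF yV] by (auto simp: s_def)
    define Z where "Z d = {z. z \<notin> s \<and> (\<exists>x\<in>d. {x, z} \<in> E \<and> r x z \<in> J)}" for d
    define W where "W d B = T ^ card (reach (B - out_items d) (A - {y} \<union> Z d))" for d B
    define \<D> where "\<D> = {d. y \<in> d \<and> d \<subseteq> s}"
    define ind where "ind d B = (if reach_in s B y = d then 1 else 0 :: real)" for d B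
    have fin\<D>: "finite \<D>" using s by (auto simp: \<D>_def)
    have D: "reach_in s B y \<in> \<D>" for B
      using reach_in_self reach_in_subset[OF s(2)] by (auto simp: \<D>_def)
    have finZ: "finite (Z d)" if "d \<in> \<D>" for d
    proof -
      have "Z d \<subseteq> (\<Union>x\<in>d. {z. {x, z} \<in> E})" by (auto simp: Z_def)
      moreover have "finite d" using that s finite_subset by (auto simp: \<D>_def)
      ultimately show ?thesis using finite_nbrs by (auto intro: finite_subset)
    qed
    have decomp: "T ^ card (reach B A) \<le> T ^ card s * W d B" if "B \<subseteq> J" "reach_in s B y = d" for B d
    proof -
      let ?R = "reach (B - out_items d) (A - {y} \<union> Z d)"
      have d: "d \<in> \<D>" "d \<subseteq> s" using D that by (auto simp: \<D>_def)
      then have "finite d" using s finite_subset by auto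
      have finR: "finite ?R"
        using finite_reach finZ[OF d(1)] finite_subset[OF that(1)] fin by auto
      have "reach B A \<subseteq> d \<union> ?R"
        using reach_decomp[OF y s(2) that(2)[symmetric] that(1)] by (simp add: Z_def)
      then have "card (reach B A) \<le> card (d \<union> ?R)"
        using finR \<open>finite d\<close> by (intro card_mono) auto
      also have "\<dots> \<le> card d + card ?R" by (rule card_Un_le)
      also have "\<dots> \<le> card s + card ?R" using d s by (simp add: card_mono)
      finally show ?thesis
        using T power_increasing[of "card (reach B A)" "card s + card ?R" T] by (simp add: W_def power_add)
    qed
    have IH: "bexp J p (W d) \<le> K ^ (card A - 1) * K ^ card (Z d)" if d: "d \<in> \<D>" for d
    proof -
      have "((J - out_items d, A - {y} \<union> Z d), (J, A))
          \<in> measures [\<lambda>x. card (fst x), \<lambda>x. card (snd x)]"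
      proof (cases "J \<inter> out_items d = {}")
        case True
        then have "Z d = {}" by (auto simp: Z_def out_items_def)
        moreover have "J - out_items d = J" using True by auto
        moreover have "card (A - {y}) < card A" using y fin by (intro card_Diff1_less)
        ultimately show ?thesis by simp
      next
        case False
        then have "card (J - out_items d) < card J" using fin by (intro psubset_card_mono) auto
        then show ?thesis by simp
      qed
      moreover have "A - {y} \<union> Z d \<subseteq> V" using AV edge_V by (auto simp: Z_def)
      ultimately have "bexp (J - out_items d) p (\<lambda>B. T ^ card (reach B (A - {y} \<union> Z d)))
          \<le> K ^ card (A - {y} \<union> Z d)"
        using fin finZ[OF d] by (intro 1(1)) auto
      also have "\<dots> \<le> K ^ (card A - 1 + card (Z d))"
        using card_Un_le[of "A - {y}" "Z d"] y fin K by (intro power_increasing) auto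
      also have "bexp (J - out_items d) p (\<lambda>B. T ^ card (reach B (A - {y} \<union> Z d))) = bexp (J - out_items d) p (W d)"
      proof (rule bexp_cong)
        fix B assume "B \<subseteq> J - out_items d"
        then have "B - out_items d = B" by auto
        then show "T ^ card (reach B (A - {y} \<union> Z d)) = W d B" by (simp add: W_def)
      qed
      also have "\<dots> = bexp J p (W d)"
        using bexp_restrict[of J "W d" "- out_items d" p] fin by (simp add: W_def Diff_eq)
      finally show ?thesis by (simp add: power_add)
    qed
    \<comment> \<open>Split according to the cluster \<open>d\<close> found inside \<open>s\<close>;
      exactly one indicator \<open>ind d\<close> is nonzero.\<close>
    have "bexp J p (\<lambda>B. T ^ card (reach B A)) \<le> bexp J p (\<lambda>B. \<Sum>d\<in>\<D>. T ^ card s * (ind d B * W d B))"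
    proof (rule bexp_mono[OF p])
      fix B assume B: "B \<subseteq> J"
      have "(\<Sum>d\<in>\<D>. T ^ card s * (ind d B * W d B)) = (\<Sum>d\<in>{reach_in s B y}. T ^ card s * (ind d B * W d B))"
        using fin\<D> D by (intro sum.mono_neutral_right) (auto simp: ind_def)
      then show "T ^ card (reach B A) \<le> (\<Sum>d\<in>\<D>. T ^ card s * (ind d B * W d B))"
        using decomp[OF B refl] by (simp add: ind_def)
    qed
    also have "\<dots> = (\<Sum>d\<in>\<D>. T ^ card s * (bexp J p (ind d) * bexp J p (W d)))"
      unfolding bexp_sum bexp_cmult
    proof (intro sum.cong arg_cong2[of _ _ _ _ "(*)"] refl)
      fix d
      \<comment> \<open>\<open>ind d\<close> looks only at \<open>out_items d\<close>, and
        \<open>W d\<close> only at the other items.\<close>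
      show "bexp J p (\<lambda>B. ind d B * W d B) = bexp J p (ind d) * bexp J p (W d)"
        using fin reach_in_determined[OF s(2)]
        by (intro bexp_indep[where K = "out_items d"]) (auto simp: ind_def W_def)
    qed
    also have "\<dots> \<le> (\<Sum>d\<in>\<D>. T ^ card s * (bexp J p (ind d) * (K ^ (card A - 1) * K ^ card (Z d))))"
    proof (intro sum_mono mult_left_mono IH)
      show "0 \<le> bexp J p (ind d)" for d
        using bexp_mono[OF p, of J "\<lambda>_. 0" "ind d"] fin by (simp add: ind_def bexp_const)
    qed (use T in auto)
    also have "\<dots> = K ^ (card A - 1) * (T ^ card s * bexp J p (\<lambda>B. \<Sum>d\<in>\<D>. K ^ card (Z d) * ind d B))"
      unfolding bexp_sum bexp_cmult sum_distrib_left by (intro sum.cong) auto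
    \<comment> \<open>\<open>Z d\<close> counts only exits through items of \<open>J\<close>, so it
      is no larger than \<open>bdry s B y\<close>, the set that \<open>step\<close>
      controls.\<close>
    also have "\<dots> \<le> K ^ (card A - 1) * (T ^ card s * bexp J p (\<lambda>B. K ^ card (bdry s B y)))"
    proof (intro mult_left_mono bexp_mono[OF p])
      fix B
      have "(\<Sum>d\<in>\<D>. K ^ card (Z d) * ind d B) = (\<Sum>d\<in>{reach_in s B y}. K ^ card (Z d) * ind d B)"
        using fin\<D> D by (intro sum.mono_neutral_right) (auto simp: ind_def)
      also have "\<dots> \<le> K ^ card (bdry s B y)"
        using K finite_bdry[OF s, of B] unfolding ind_def
        by (auto intro!: power_increasing card_mono simp: bdry_def Z_def)
      finally show "(\<Sum>d\<in>\<D>. K ^ card (Z d) * ind d B) \<le> K ^ card (bdry s B y)" .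
    qed (use T K in auto)
    also have "\<dots> \<le> K ^ (card A - 1) * K"
      using step[OF yV fin(1)] K by (intro mult_left_mono) (auto simp: s_def)
    also have "\<dots> = K ^ card A"
      using y fin by (metis card_Suc_Diff1 card_Diff_singleton mult.commute power_Suc)
    finally show ?thesis .
  qed
qed

end

section \<open>Exponential moments and escape probabilities\<close>

lemma bexp_exp_has_derivative:
  fixes p :: real
  shows "((\<lambda>s. bexp J p (\<lambda>B. exp (s * f B))) has_real_derivative bexp J p f) (at 0)"
  unfolding bexp_def by (auto intro!: derivative_eq_intros sum.cong)

text \<open>At \<open>s = 0\<close> both sides equal 1, and their derivatives there are
  \<open>bexp J p f < 1\<close> and 1, so the strict inequality holds for small positive
  \<open>s\<close>.\<close>

lemma bexp_exp_less:
  fixes p :: real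
  assumes "finite J" "bexp J p f < 1"
  shows "\<exists>s>0. bexp J p (\<lambda>B. exp (s * f B)) < exp s"
proof -
  let ?F = "\<lambda>s. bexp J p (\<lambda>B. exp (s * f B)) - exp s"
  have "(?F has_real_derivative bexp J p f - 1) (at 0)"
    by (rule derivative_eq_intros bexp_exp_has_derivative refl | simp)+
  then obtain d where d: "d > 0" "\<And>h. 0 < h \<Longrightarrow> h < d \<Longrightarrow> ?F (0 + h) < ?F 0"
    using DERIV_neg_dec_right[of ?F "bexp J p f - 1" 0] assms(2) by auto
  have "?F 0 = 0" using assms(1) by (simp add: bexp_const)
  then show ?thesis using d(2)[of "d / 2"] d(1) by (intro exI[of _ "d / 2"]) auto
qed

context item_graph
begin

text \<open>The exploration runs with an arbitrary finite \<open>J\<close>. Fewer available items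
  give fewer exits, and \<open>1 \<le> K\<close> makes the moment increasing in them, so the full
  set \<open>inner_items S\<close> is the worst case.\<close>

lemma bexp_bdry_moment_le:
  fixes p K :: real
  assumes "0 \<le> p" "p \<le> 1" "1 \<le> K" "finite J" "finite S" "y \<in> S"
  shows "bexp J p (\<lambda>B. K ^ card (bdry S B y)) \<le> bexp (inner_items S) p (\<lambda>B. K ^ card (bdry S B y))"
proof -
  have mono: "mono (\<lambda>B. K ^ card (bdry S B y))"
    using assms finite_bdry bdry_mono by (intro monoI power_increasing card_mono) auto
  have "bexp J p (\<lambda>B. K ^ card (bdry S B y)) = bexp (J \<inter> inner_items S) p (\<lambda>B. K ^ card (bdry S B y))"
    using assms by (intro bexp_restrict) (auto simp: bdry_local)
  also have "\<dots> \<le> bexp (inner_items S) p (\<lambda>B. K ^ card (bdry S B y))"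
    using assms finite_inner_items mono by (intro bexp_mono_set) auto
  finally show ?thesis .
qed

text \<open>A mean number of exits below 1 gives a \<open>K\<close> for which the moment
  \<open>M\<close> is less than \<open>K\<close>; the slack \<open>K / M\<close> is then distributed
  as one factor \<open>T\<close> per vertex of \<open>S\<close>.\<close>

lemma exists_moment_parameters:
  fixes p :: real
  assumes p: "0 \<le> p" "p \<le> 1" and S: "finite S" "y \<in> S"
    and small: "bexp (inner_items S) p (\<lambda>B. real (card (bdry S B y))) < 1"
  shows "\<exists>K T. K > 1 \<and> T > 1 \<and>
    T ^ card S * bexp (inner_items S) p (\<lambda>B. K ^ card (bdry S B y)) \<le> K"
proof -
  have fin: "finite (inner_items S)" using S finite_inner_items by auto
  obtain s where s: "s > 0"
      "bexp (inner_items S) p (\<lambda>B. exp (s * real (card (bdry S B y)))) < exp s"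
    using bexp_exp_less[OF fin small] by auto
  define K where "K = exp s"
  define M where "M = bexp (inner_items S) p (\<lambda>B. K ^ card (bdry S B y))"
  have "K > 1" using s by (simp add: K_def)
  have "M < K"
    using s(2) by (simp add: M_def K_def exp_of_nat_mult[symmetric] mult.commute)
  have "1 \<le> M"
    using bexp_mono[OF p, of "inner_items S" "\<lambda>_. 1" "\<lambda>B. K ^ card (bdry S B y)"] \<open>K > 1\<close> fin
    by (simp add: M_def bexp_const one_le_power)
  define T where "T = root (card S) (K / M)"
  have "card S > 0" using S by (auto simp: card_gt_0_iff)
  moreover have "K / M > 1" using \<open>M < K\<close> \<open>1 \<le> M\<close> by simp
  ultimately have "T > 1" "T ^ card S = K / M"
    by (auto simp: T_def)
  then show ?thesis
    using \<open>1 \<le> M\<close> \<open>K > 1\<close> by (intro exI[of _ K] exI[of _ T]) (simp add: M_def)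
qed

section \<open>Transport along graph automorphisms\<close>

lemma bdry_automorphism:
  assumes f: "graph_automorphism V E f"
    and h: "inj_on h I" "\<And>x y. {x, y} \<in> E \<Longrightarrow> r (f x) (f y) = h (r x y)"
    and S: "S \<subseteq> V" "y \<in> S" and B: "B \<subseteq> I"
  shows "bdry (f ` S) (h ` B) (f y) \<subseteq> f ` bdry S B y"
proof
  have edge: "{f x, f x'} \<in> E \<longleftrightarrow> {x, x'} \<in> E" if "x \<in> V" "x' \<in> V" for x x'
    using f that by (auto simp: graph_automorphism_def)
  have D: "reach_in S B y \<subseteq> S" using reach_in_subset S by auto
  have reach: "w \<in> f ` reach_in S B y" if "(f y, w) \<in> (arcs (h ` B) \<inter> f ` S \<times> f ` S)\<^sup>*" for w
    using that
  proof (induction)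
    case base
    then show ?case using reach_in_self by auto
  next
    case (step w w')
    then obtain x x' where x: "w = f x" "x \<in> reach_in S B y" "w' = f x'" "x' \<in> S" by auto
    have e: "{f x, f x'} \<in> E" "r (f x) (f x') \<in> h ` B"
      using step.hyps x by (auto simp: arcs_def)
    then have e': "{x, x'} \<in> E" using edge x D S by auto
    then have "h (r x x') \<in> h ` B" using e h by auto
    then have "r x x' \<in> B" using h(1) B item_in[OF e'] by (auto simp: inj_on_def)
    then show ?case using reach_in_step[OF x(2) S(2) e'] x by auto
  qed
  fix z assume "z \<in> bdry (f ` S) (h ` B) (f y)"
  then obtain x where z: "z \<notin> f ` S" "x \<in> reach_in S B y" "{f x, z} \<in> E"
    using reach by (auto simp: bdry_def reach_in_def)
  have "z \<in> V" using edge_V z by blast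
  then obtain z0 where z0: "z0 \<in> V" "z = f z0"
    using f unfolding graph_automorphism_def bij_betw_def by blast
  have "z0 \<notin> S" using z z0 by auto
  moreover have "{x, z0} \<in> E" using edge[of x z0] z z0 D S by auto
  ultimately show "z \<in> f ` bdry S B y" using z z0 by (auto simp: bdry_def)
qed

lemma inner_items_automorphism:
  assumes f: "graph_automorphism V E f"
    and h: "\<And>x y. {x, y} \<in> E \<Longrightarrow> r (f x) (f y) = h (r x y)"
    and S: "S \<subseteq> V"
  shows "inner_items (f ` S) = h ` inner_items S"
proof -
  have edge: "{f x, f x'} \<in> E \<longleftrightarrow> {x, x'} \<in> E" if "x \<in> S" "x' \<in> S" for x x'
    using f that S by (auto simp: graph_automorphism_def)
  show ?thesis
  proof
    show "inner_items (f ` S) \<subseteq> h ` inner_items S"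
      using edge h unfolding inner_items_def by blast
    show "h ` inner_items S \<subseteq> inner_items (f ` S)"
    proof
      fix i assume "i \<in> h ` inner_items S"
      then obtain x x' where "x \<in> S" "x' \<in> S" "{x, x'} \<in> E" "i = h (r x x')"
        unfolding inner_items_def by blast
      then show "i \<in> inner_items (f ` S)"
        using edge[of x x'] h[of x x'] unfolding inner_items_def by force
    qed
  qed
qed

text \<open>The automorphism must also act on the items, through an injective \<open>h\<close>, so
  that the product weights are preserved: \<open>h\<close> is the image map of \<open>f\<close> for
  bonds and \<open>f\<close> itself for sites.\<close>

definition items_transitive_from :: "'a \<Rightarrow> bool" where
  "items_transitive_from x0 \<longleftrightarrow> (\<forall>y\<in>V. \<exists>f h. graph_automorphism V E f \<and> f x0 = y \<and> inj_on h I \<and>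
    (\<forall>x x'. {x, x'} \<in> E \<longrightarrow> r (f x) (f x') = h (r x x')))"

text \<open>Translates of \<open>S\<close> serve as exploration sets around all vertices, and
  transport makes the one pair \<open>K\<close>, \<open>T\<close> found at \<open>y0\<close> valid
  for each of them. The bound is uniform in \<open>J\<close>, hence survives the passage to
  infinitely many items.\<close>

lemma exp_moment_of_small_boundary:
  fixes p :: real
  assumes p: "0 \<le> p" "p \<le> 1" and S: "finite S" "S \<subseteq> V" "y0 \<in> S"
    and small: "bexp (inner_items S) p (\<lambda>B. real (card (bdry S B y0))) < 1"
    and trans: "items_transitive_from y0"
  shows "\<exists>K T. K > 1 \<and> T > 1 \<and> (\<forall>J. finite J \<longrightarrow> bexp J p (\<lambda>B. T ^ card (reach B {y0})) \<le> K)"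
proof -
  obtain K T where KT: "K > 1" "T > 1"
      "T ^ card S * bexp (inner_items S) p (\<lambda>B. K ^ card (bdry S B y0)) \<le> K"
    using exists_moment_parameters[OF p S(1,3) small] by auto
  obtain f h where fh: "\<And>y. y \<in> V \<Longrightarrow> graph_automorphism V E (f y) \<and> f y y0 = y \<and> inj_on (h y) I \<and>
      (\<forall>x x'. {x, x'} \<in> E \<longrightarrow> r (f y x) (f y x') = h y (r x x'))"
    using trans unfolding items_transitive_from_def by metis
  have step: "T ^ card (f y ` S) * bexp J p (\<lambda>B. K ^ card (bdry (f y ` S) B y)) \<le> K"
    if y: "y \<in> V" and J: "finite J" for y J
  proof -
    note a = fh[OF y]
    have "y \<in> f y ` S" using a S(3) by (metis imageI)
    have inj: "inj_on (h y) (inner_items S)"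
      using a inner_subset_out out_items_subset by (meson inj_on_subset subset_trans)
    have inj_f: "inj_on (f y) S"
      using a S by (auto simp: graph_automorphism_def bij_betw_def intro: inj_on_subset)
    have "bexp J p (\<lambda>B. K ^ card (bdry (f y ` S) B y))
        \<le> bexp (inner_items (f y ` S)) p (\<lambda>B. K ^ card (bdry (f y ` S) B y))"
      using \<open>y \<in> f y ` S\<close> S KT J by (intro bexp_bdry_moment_le[OF p]) auto
    also have "inner_items (f y ` S) = h y ` inner_items S"
      using inner_items_automorphism[of "f y" "h y" S] a S by blast
    also have "bexp (h y ` inner_items S) p (\<lambda>B. K ^ card (bdry (f y ` S) B y))
        = bexp (inner_items S) p (\<lambda>B. K ^ card (bdry (f y ` S) (h y ` B) y))"
      by (rule bexp_image[OF inj])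
    also have "\<dots> \<le> bexp (inner_items S) p (\<lambda>B. K ^ card (bdry S B y0))"
    proof (intro bexp_mono[OF p] power_increasing)
      fix B assume "B \<subseteq> inner_items S"
      then have "B \<subseteq> I" using inner_subset_out out_items_subset by blast
      then have "bdry (f y ` S) (h y ` B) y \<subseteq> f y ` bdry S B y0"
        using bdry_automorphism[of "f y" "h y" S y0 B] a S by auto
      then show "card (bdry (f y ` S) (h y ` B) y) \<le> card (bdry S B y0)"
        using finite_bdry[OF S(1,3)] surj_card_le by blast
    qed (use KT in auto)
    finally have "T ^ card S * bexp J p (\<lambda>B. K ^ card (bdry (f y ` S) B y))
        \<le> T ^ card S * bexp (inner_items S) p (\<lambda>B. K ^ card (bdry S B y0))"
      using KT by (intro mult_left_mono) auto
    also have "\<dots> \<le> K" by (rule KT)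
    finally show ?thesis by (simp add: card_image[OF inj_f])
  qed
  have "bexp J p (\<lambda>B. T ^ card (reach B {y0})) \<le> K ^ card {y0}" if "finite J" for J
  proof (rule bexp_reach_moment[OF p _ _ _ step that])
    show "finite (f y ` S) \<and> y \<in> f y ` S" if "y \<in> V" for y
      using fh[OF that] S by (metis finite_imageI imageI)
  qed (use KT S in auto)
  then show ?thesis using KT by auto
qed

section \<open>Escape from a finite set and its differential inequality\<close>

definition escape :: "'a set \<Rightarrow> 'i set \<Rightarrow> 'a set" where
  "escape L B = {x. \<exists>w. w \<notin> L \<and> (x, w) \<in> (arcs B)\<^sup>*}"

lemma escape_outside: "x \<notin> L \<Longrightarrow> x \<in> escape L B"
  by (auto simp: escape_def)

lemma escape_step: "(x, y) \<in> arcs B \<Longrightarrow> y \<in> escape L B \<Longrightarrow> x \<in> escape L B"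
  unfolding escape_def by (blast intro: converse_rtrancl_into_rtrancl)

lemma escape_mono: "B \<subseteq> B' \<Longrightarrow> escape L B \<subseteq> escape L B'"
  unfolding escape_def using rtrancl_mono[OF arcs_mono] by blast

lemma escape_induct [consumes 1, case_names outside step]:
  assumes "x \<in> escape L B"
    and "\<And>x. x \<notin> L \<Longrightarrow> P x"
    and "\<And>x y. (x, y) \<in> arcs B \<Longrightarrow> y \<in> escape L B \<Longrightarrow> P y \<Longrightarrow> P x"
  shows "P x"
proof -
  obtain w where w: "w \<notin> L" "(x, w) \<in> (arcs B)\<^sup>*" using assms(1) by (auto simp: escape_def)
  have "P x \<and> x \<in> escape L B"
    using w(2)
    by (induction rule: converse_rtrancl_induct)
      (use w(1) assms(2,3) escape_outside escape_step in blast)+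
  then show ?thesis by simp
qed

text \<open>This makes the event \<open>escape L B = - S\<close> independent of \<open>bdry S B x0\<close>.\<close>

lemma escape_determined:
  assumes S: "escape L B = - S" and BB: "B - inner_items S = B' - inner_items S"
  shows "escape L B' = - S"
proof
  show "- S \<subseteq> escape L B'"
  proof
    fix x assume "x \<in> - S"
    then have "x \<in> escape L B" using S by simp
    then show "x \<in> escape L B'"
    proof (induction rule: escape_induct)
      case (step x y)
      then have "r x y \<notin> inner_items S" "r x y \<in> B"
        using S boundary_item_not_inner by (auto simp: arcs_def)
      then have "(x, y) \<in> arcs B'" using step BB by (auto simp: arcs_def)
      then show ?case using step escape_step by blast
    qed (rule escape_outside)
  qed
  show "escape L B' \<subseteq> - S"
  proof
    fix x assume "x \<in> escape L B'"
    then show "x \<in> - S"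
    proof (induction rule: escape_induct)
      case (outside x)
      then show ?case using S escape_outside by blast
    next
      case (step x y)
      then have "r x y \<notin> inner_items S" "r x y \<in> B'"
        using boundary_item_not_inner by (auto simp: arcs_def)
      then have "(x, y) \<in> arcs B" using step BB by (auto simp: arcs_def)
      then show ?case using step S escape_step by blast
    qed
  qed
qed

text \<open>Every vertex outside \<open>S\<close> escapes, so opening one arc into an exit
  \<open>z\<close> makes \<open>x0\<close> escape too. Distinct exits use distinct items: by
  \<open>item_head\<close> a shared item would make \<open>z\<close> either a tail in
  \<open>S\<close> or the other exit itself.\<close>

lemma pivotal_count:
  assumes L: "finite L" and J: "finite J" "out_items L \<subseteq> J"
    and S: "escape L B = - S" and x0: "x0 \<in> S"
  shows "card (bdry S B x0) \<le> card {i \<in> J. x0 \<in> escape L (insert i B)}"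
proof -
  have "S \<subseteq> L" using S escape_outside by blast
  define it where "it z = r (SOME x. x \<in> reach_in S B x0 \<and> {x, z} \<in> E) z" for z
  have it: "\<exists>x. x \<in> S \<and> x \<in> reach_in S B x0 \<and> {x, z} \<in> E \<and> it z = r x z" if "z \<in> bdry S B x0" for z
  proof -
    have "\<exists>x. x \<in> reach_in S B x0 \<and> {x, z} \<in> E" using that by (auto simp: bdry_def)
    from someI_ex[OF this] show ?thesis
      using reach_in_subset[OF x0, of B] by (auto simp: it_def)
  qed
  have "inj_on it (bdry S B x0)"
  proof (rule inj_onI)
    fix z z' assume z: "z \<in> bdry S B x0" "z' \<in> bdry S B x0" "it z = it z'"
    then obtain x x' where "x \<in> S" "x' \<in> S" "{x, z} \<in> E" "{x', z'} \<in> E" "r x z = r x' z'"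
      using it by metis
    moreover have "z \<notin> S" using z by (auto simp: bdry_def)
    ultimately show "z = z'" using item_head[of x z x' z'] by auto
  qed
  moreover have "it ` bdry S B x0 \<subseteq> {i \<in> J. x0 \<in> escape L (insert i B)}"
  proof (clarify)
    fix z assume z: "z \<in> bdry S B x0"
    then obtain x where x: "x \<in> S" "x \<in> reach_in S B x0" "{x, z} \<in> E" "it z = r x z"
      using it by blast
    have "it z \<in> J" using x J(2) \<open>S \<subseteq> L\<close> by (auto simp: out_items_def)
    moreover have "x0 \<in> escape L (insert (it z) B)"
    proof -
      have "z \<in> escape L (insert (it z) B)"
        using z S escape_mono[of B "insert (it z) B" L] by (auto simp: bdry_def)
      moreover have "(x, z) \<in> arcs (insert (it z) B)" using x by (auto simp: arcs_def)
      ultimately have "x \<in> escape L (insert (it z) B)" using escape_step by blast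
      moreover have "(x0, x) \<in> (arcs (insert (it z) B))\<^sup>*"
      proof -
        have "(x0, x) \<in> (arcs B \<inter> S \<times> S)\<^sup>*" using x by (simp add: reach_in_def)
        moreover have "arcs B \<inter> S \<times> S \<subseteq> arcs (insert (it z) B)"
          using arcs_mono[of B "insert (it z) B"] by auto
        ultimately show ?thesis using rtrancl_mono by blast
      qed
      ultimately show ?thesis by (auto simp: escape_def intro: rtrancl_trans)
    qed
    ultimately show "it z \<in> J \<and> x0 \<in> escape L (insert (it z) B)" by simp
  qed
  ultimately show ?thesis
    using J(1) by (intro card_inj_on_le) auto
qed

text \<open>Decompose by the random set \<open>S\<close> of vertices that do not escape, which lies
  in \<open>L\<close> because vertices outside \<open>L\<close> escape by the empty path. Given this
  event the exits of \<open>x0\<close> from \<open>S\<close> provide pivotal items; their number is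
  independent of the event and has mean at least 1. The events with \<open>x0 \<in> S\<close> have
  total probability \<open>1 - bexp J p f\<close>.\<close>

lemma escape_derivative_ge:
  fixes p :: real and L J x0
  defines "f \<equiv> \<lambda>B. of_bool (x0 \<in> escape L B) :: real"
  assumes p: "0 \<le> p" "p \<le> 1" and L: "finite L" and J: "finite J" "out_items L \<subseteq> J"
    and large: "\<And>S. S \<subseteq> L \<Longrightarrow> x0 \<in> S \<Longrightarrow> 1 \<le> bexp (inner_items S) p (\<lambda>B. real (card (bdry S B x0)))"
  shows "1 - bexp J p f \<le> (\<Sum>i\<in>J. bexp J p (\<lambda>B. f (insert i B) - f (B - {i})))"
proof -
  define \<S> where "\<S> = {S. S \<subseteq> L \<and> x0 \<in> S}"
  define ind where "ind S B = (if escape L B = - S then 1 else 0 :: real)" for S B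
  define N where "N S B = real (card (bdry S B x0))" for S B
  have fin: "finite \<S>" using L by (auto simp: \<S>_def)
  have sum_ind: "(\<Sum>S\<in>\<S>. g S * ind S B) = (1 - f B) * g (- escape L B)" for g B
  proof (cases "x0 \<in> escape L B")
    case True
    then have "ind S B = 0" if "S \<in> \<S>" for S using that by (auto simp: ind_def \<S>_def)
    then show ?thesis using True by (simp add: f_def)
  next
    case False
    then have "- escape L B \<in> \<S>" using escape_outside by (auto simp: \<S>_def)
    then have "(\<Sum>S\<in>\<S>. g S * ind S B) = (\<Sum>S\<in>{- escape L B}. g S * ind S B)"
      using fin by (intro sum.mono_neutral_right) (auto simp: ind_def)
    then show ?thesis using False by (simp add: f_def ind_def)
  qed
  have indep: "bexp J p (\<lambda>B. N S B * ind S B) = bexp J p (N S) * bexp J p (ind S)" for S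
  proof (rule bexp_indep[where K = "inner_items S"])
    show "ind S (B - inner_items S) = ind S B" for B
      using escape_determined[of L B S "B - inner_items S"] escape_determined[of L "B - inner_items S" S B]
      by (auto simp: ind_def)
  qed (simp_all add: N_def bdry_local J)
  have N_ge: "1 \<le> bexp J p (N S)" if "S \<in> \<S>" for S
  proof -
    have "inner_items S \<subseteq> out_items L"
      using that unfolding \<S>_def inner_items_def out_items_def by blast
    then have "J \<inter> inner_items S = inner_items S" using J by auto
    then have "bexp J p (N S) = bexp (inner_items S) p (N S)"
      using bexp_restrict[of J "N S" "inner_items S" p] J by (simp add: N_def bdry_local)
    then show ?thesis using large[of S] that by (simp add: \<S>_def N_def[abs_def])
  qed
  have ind_nonneg: "0 \<le> bexp J p (ind S)" for S
    using bexp_mono[OF p, of J "\<lambda>_. 0" "ind S"] J by (simp add: ind_def bexp_const)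
  have "1 - bexp J p f = bexp J p (\<lambda>B. \<Sum>S\<in>\<S>. 1 * ind S B)"
    unfolding sum_ind using J by (simp add: bexp_diff bexp_const)
  also have "\<dots> = (\<Sum>S\<in>\<S>. 1 * bexp J p (ind S))"
    unfolding bexp_sum bexp_cmult ..
  also have "\<dots> \<le> (\<Sum>S\<in>\<S>. bexp J p (N S) * bexp J p (ind S))"
    using N_ge ind_nonneg by (intro sum_mono mult_right_mono) auto
  also have "\<dots> = bexp J p (\<lambda>B. \<Sum>S\<in>\<S>. N S B * ind S B)"
    unfolding bexp_sum indep ..
  also have "\<dots> \<le> bexp J p (\<lambda>B. \<Sum>i\<in>J. f (insert i B) - f (B - {i}))"
  proof (rule bexp_mono[OF p])
    fix B assume "B \<subseteq> J"
    have f_mono: "f B \<le> f B'" if "B \<subseteq> B'" for B B'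
      using escape_mono[OF that] by (auto simp: f_def)
    have "(\<Sum>S\<in>\<S>. N S B * ind S B) = (1 - f B) * N (- escape L B) B"
      using sum_ind[of "\<lambda>S. N S B" B] by simp
    also have "\<dots> \<le> (\<Sum>i\<in>J. f (insert i B) - f B)"
    proof (cases "x0 \<in> escape L B")
      case True
      then have "(1 - f B) * N (- escape L B) B = 0" by (simp add: f_def)
      moreover have "0 \<le> (\<Sum>i\<in>J. f (insert i B) - f B)"
        by (intro sum_nonneg) (simp add: f_mono subset_insertI)
      ultimately show ?thesis by (simp only:)
    next
      case False
      have "(\<Sum>i\<in>J. f (insert i B) - f B) = real (card {i \<in> J. x0 \<in> escape L (insert i B)})"
        using False J by (simp add: f_def sum.If_cases of_bool_def Int_def)
      then show ?thesis
        using pivotal_count[OF L J, where B = B and S = "- escape L B" and ?x0.0 = x0] False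
        by (simp add: N_def f_def)
    qed
    also have "\<dots> \<le> (\<Sum>i\<in>J. f (insert i B) - f (B - {i}))"
      using f_mono by (intro sum_mono diff_left_mono) auto
    finally show "(\<Sum>S\<in>\<S>. N S B * ind S B) \<le> (\<Sum>i\<in>J. f (insert i B) - f (B - {i}))" .
  qed
  finally show ?thesis by (simp add: bexp_sum)
qed

text \<open>Integrating \<theta>' \<ge> 1 - \<theta>: the function (1 - \<theta>(t)) exp t is
  nonincreasing on [p, q], and its value at p is at most exp p.\<close>

lemma escape_probability_ge:
  fixes p q :: real
  assumes pq: "0 \<le> p" "p < q" "q \<le> 1" and L: "finite L" and J: "finite J" "out_items L \<subseteq> J"
    and large: "\<And>S t. S \<subseteq> L \<Longrightarrow> x0 \<in> S \<Longrightarrow> p < t \<Longrightarrow> t < q \<Longrightarrow>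
      1 \<le> bexp (inner_items S) t (\<lambda>B. real (card (bdry S B x0)))"
  shows "1 - exp (- (q - p)) \<le> bexp J q (\<lambda>B. of_bool (x0 \<in> escape L B))"
proof -
  define f where "f B = (of_bool (x0 \<in> escape L B) :: real)" for B
  define D where "D t = (\<Sum>i\<in>J. bexp J t (\<lambda>B. f (insert i B) - f (B - {i})))" for t :: real
  let ?g = "\<lambda>t. (1 - bexp J t f) * exp t"
  have deriv: "(?g has_real_derivative (1 - bexp J t f - D t) * exp t) (at t)" for t
    unfolding D_def
    by (rule derivative_eq_intros russo_formula[OF J(1)] refl | simp add: algebra_simps)+
  have "?g q \<le> ?g p"
  proof (rule DERIV_nonpos_imp_decreasing_open[where f = ?g])
    fix t assume t: "p < t" "t < q"
    have "1 - bexp J t f \<le> D t"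
      unfolding D_def f_def
      using t pq large by (intro escape_derivative_ge[OF _ _ L J]) auto
    then show "\<exists>y. (?g has_real_derivative y) (at t) \<and> y \<le> 0"
      using deriv by (intro exI[of _ "(1 - bexp J t f - D t) * exp t"]) (auto simp: mult_le_0_iff)
  next
    show "continuous_on {p..q} ?g"
      using deriv by (meson DERIV_continuous continuous_at_imp_continuous_on)
  qed (use pq in auto)
  also have "\<dots> \<le> exp p"
    using bexp_mono[of p J "\<lambda>_. 0" f] pq J by (simp add: f_def bexp_const)
  finally have "(1 - bexp J q f) * exp q * exp (- q) \<le> exp p * exp (- q)"
    by (rule mult_right_mono) simp
  then have "1 - bexp J q f \<le> exp (- (q - p))"
    by (simp add: mult.assoc flip: exp_add)
  then show ?thesis by (simp add: f_def[abs_def])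
qed

end

section \<open>Infinite configurations\<close>

lemma bexp_zero: "finite J \<Longrightarrow> bexp J 0 f = f {}"
  by (induction J rule: finite_induct) (simp_all add: bexp_insert)

lemma countable_exhaustion:
  assumes "countable X"
  obtains K :: "nat \<Rightarrow> 'x set" where "\<And>n. finite (K n)" "\<And>n. K n \<subseteq> X" "incseq K" "(\<Union>n. K n) = X"
proof
  let ?K = "\<lambda>n. {x \<in> X. to_nat_on X x \<le> n}"
  show "finite (?K n)" for n
  proof (rule inj_on_finite[of "to_nat_on X"])
    show "inj_on (to_nat_on X) (?K n)"
      using assms inj_on_to_nat_on inj_on_subset by (metis (no_types, lifting) mem_Collect_eq subsetI)
    show "to_nat_on X ` ?K n \<subseteq> {..n}" by auto
  qed simp
  show "incseq ?K" by (auto simp: incseq_def)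
qed auto

lemma finite_subset_incseq_UN:
  assumes "finite F" "F \<subseteq> (\<Union>n. K n)" "incseq K"
  shows "\<exists>n::nat. F \<subseteq> K n"
  using assms(1,2)
proof (induction F rule: finite_induct)
  case (insert x F)
  then obtain m n where "F \<subseteq> K m" "x \<in> K n" by auto
  then have "insert x F \<subseteq> K (max m n)"
    using assms(3) by (meson incseqD insert_subset max.cobounded1 max.cobounded2 order_trans subsetD)
  then show ?case by blast
qed simp

text \<open>Through finite subsets the event of a large cluster becomes a countable union of events
  about finitely many vertices, which yields both measurability and finite witnesses.\<close>

lemma set_size_ge_iff: "enat n \<le> set_size A \<longleftrightarrow> (\<exists>X\<subseteq>A. finite X \<and> card X = n)"
proof (cases "finite A")
  case True
  then have "n \<le> card A \<longleftrightarrow> (\<exists>X\<subseteq>A. finite X \<and> card X = n)"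
    by (metis card_mono obtain_subset_with_card_n)
  then show ?thesis using True by (simp add: set_size_def)
next
  case False
  then show ?thesis using infinite_arbitrarily_large[of A n] by (auto simp: set_size_def)
qed

lemma set_size_mono: "A \<subseteq> B \<Longrightarrow> set_size A \<le> set_size B"
  by (auto simp: set_size_def card_mono dest: finite_subset)

lemma prob_space_percolation_law: "prob_space (percolation_law I p)"
  unfolding percolation_law_def by (intro prob_space_PiM measure_pmf.prob_space_axioms)

definition opened :: "'i set \<Rightarrow> ('i \<Rightarrow> bool) \<Rightarrow> 'i set" where
  "opened I \<omega> = {i \<in> I. \<omega> i}"

lemma percolation_law_cylinder:
  assumes J: "finite J" "J \<subseteq> I" and p: "0 \<le> p" "p \<le> 1" and B: "B \<subseteq> J"
  shows "{\<omega> \<in> space (percolation_law I p). opened I \<omega> \<inter> J = B} \<in> sets (percolation_law I p)"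
    and "measure (percolation_law I p) {\<omega> \<in> space (percolation_law I p). opened I \<omega> \<inter> J = B}
      = p ^ card B * (1 - p) ^ card (J - B)"
proof -
  interpret product_prob_space "\<lambda>_. measure_pmf (bernoulli_pmf p)" I
    by unfold_locales
  \<comment> \<open>\<open>{i \<in> B}\<close> is a one-element set of truth values: coordinate
    \<open>i\<close> must be in the state that \<open>B\<close> prescribes.\<close>
  have eq: "{\<omega> \<in> space (percolation_law I p). opened I \<omega> \<inter> J = B}
      = prod_emb I (\<lambda>_. measure_pmf (bernoulli_pmf p)) J (\<Pi>\<^sub>E i\<in>J. {i \<in> B})"
    using J B by (auto simp: percolation_law_def space_PiM prod_emb_def opened_def PiE_iff extensional_def)
  show "{\<omega> \<in> space (percolation_law I p). opened I \<omega> \<inter> J = B} \<in> sets (percolation_law I p)"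
    unfolding eq unfolding percolation_law_def using J by (intro sets_PiM_I) auto
  have "measure (percolation_law I p) {\<omega> \<in> space (percolation_law I p). opened I \<omega> \<inter> J = B}
      = (\<Prod>i\<in>J. measure (measure_pmf (bernoulli_pmf p)) {i \<in> B})"
    unfolding eq unfolding percolation_law_def using J by (intro measure_PiM_emb) auto
  also have "\<dots> = (\<Prod>i\<in>J. if i \<in> B then p else 1 - p)"
    using p by (intro prod.cong refl) (auto simp: measure_pmf_single)
  also have "\<dots> = p ^ card B * (1 - p) ^ card (J - B)"
    using J B by (simp add: prod.If_cases Int_absorb1 Diff_eq)
  finally show "measure (percolation_law I p) {\<omega> \<in> space (percolation_law I p). opened I \<omega> \<inter> J = B}
      = p ^ card B * (1 - p) ^ card (J - B)" .
qed

text \<open>The passage between the product measure and \<open>bexp\<close>: an event that looks at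
  finitely many items is a finite disjoint union of cylinders.\<close>

lemma percolation_law_finite:
  assumes J: "finite J" "J \<subseteq> I" and p: "0 \<le> p" "p \<le> 1"
  shows "{\<omega> \<in> space (percolation_law I p). P (opened I \<omega> \<inter> J)} \<in> sets (percolation_law I p)"
    and "measure (percolation_law I p) {\<omega> \<in> space (percolation_law I p). P (opened I \<omega> \<inter> J)}
      = bexp J p (\<lambda>B. of_bool (P B))"
proof -
  interpret prob_space "percolation_law I p" by (rule prob_space_percolation_law)
  let ?S = "\<lambda>B. {\<omega> \<in> space (percolation_law I p). opened I \<omega> \<inter> J = B}"
  let ?\<B> = "{B. B \<subseteq> J \<and> P B}"
  have eq: "{\<omega> \<in> space (percolation_law I p). P (opened I \<omega> \<inter> J)} = (\<Union>B\<in>?\<B>. ?S B)"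
    by auto
  have fin: "finite ?\<B>" using J by auto
  have meas: "?S B \<in> sets (percolation_law I p)" if "B \<in> ?\<B>" for B
    using percolation_law_cylinder(1)[OF J p] that by auto
  show "{\<omega> \<in> space (percolation_law I p). P (opened I \<omega> \<inter> J)} \<in> sets (percolation_law I p)"
    unfolding eq using fin meas by blast
  have "measure (percolation_law I p) (\<Union>B\<in>?\<B>. ?S B) = (\<Sum>B\<in>?\<B>. measure (percolation_law I p) (?S B))"
    using fin meas by (intro finite_measure_finite_Union) (auto simp: disjoint_family_on_def)
  also have "\<dots> = (\<Sum>B\<in>?\<B>. p ^ card B * (1 - p) ^ card (J - B))"
    using percolation_law_cylinder(2)[OF J p] by (intro sum.cong) auto
  also have "\<dots> = bexp J p (\<lambda>B. of_bool (P B))"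
    unfolding bexp_def using J by (intro sum.mono_neutral_cong_left) auto
  finally show "measure (percolation_law I p) {\<omega> \<in> space (percolation_law I p). P (opened I \<omega> \<inter> J)}
      = bexp J p (\<lambda>B. of_bool (P B))"
    unfolding eq .
qed

section \<open>Clusters as monotone, finitely witnessed functions of the open items\<close>

locale cluster_model =
  fixes V :: "'a set" and I :: "'i set" and C :: "'i set \<Rightarrow> 'a set"
  assumes vertices_countable: "countable V" and items_countable: "countable I"
    and cluster_subset: "C B \<subseteq> V"
    and cluster_mono: "B \<subseteq> B' \<Longrightarrow> C B \<subseteq> C B'"
    and cluster_finitary: "w \<in> C B \<Longrightarrow> \<exists>F\<subseteq>B. finite F \<and> w \<in> C F"
begin

lemma sets_mem_cluster:
  assumes p: "0 \<le> p" "p \<le> 1"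
  shows "{\<omega> \<in> space (percolation_law I p). w \<in> C (opened I \<omega>)} \<in> sets (percolation_law I p)"
proof -
  let ?F = "{F. finite F \<and> F \<subseteq> I \<and> w \<in> C F}"
  have "{\<omega> \<in> space (percolation_law I p). w \<in> C (opened I \<omega>)}
      = (\<Union>F\<in>?F. {\<omega> \<in> space (percolation_law I p). F \<subseteq> opened I \<omega> \<inter> F})"
  proof safe
    fix \<omega> assume "\<omega> \<in> space (percolation_law I p)" "w \<in> C (opened I \<omega>)"
    then show "\<omega> \<in> (\<Union>F\<in>?F. {\<omega> \<in> space (percolation_law I p). F \<subseteq> opened I \<omega> \<inter> F})"
      using cluster_finitary[of w "opened I \<omega>"] by (fastforce simp: opened_def)
  next
    fix \<omega> F assume "w \<in> C F" "F \<subseteq> opened I \<omega> \<inter> F"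
    then show "w \<in> C (opened I \<omega>)" using cluster_mono[of F "opened I \<omega>"] by auto
  qed
  moreover have "countable ?F"
    using countable_Collect_finite_subset[OF items_countable] by (rule countable_subset[rotated]) auto
  moreover have "{\<omega> \<in> space (percolation_law I p). F \<subseteq> opened I \<omega> \<inter> F} \<in> sets (percolation_law I p)"
    if "F \<in> ?F" for F
    using percolation_law_finite(1)[of F I p "\<lambda>B. F \<subseteq> B"] that p by auto
  ultimately show ?thesis by (auto intro: sets.countable_UN')
qed

lemma sets_subset_cluster:
  assumes p: "0 \<le> p" "p \<le> 1" and "finite X"
  shows "{\<omega> \<in> space (percolation_law I p). X \<subseteq> C (opened I \<omega>)} \<in> sets (percolation_law I p)"
  unfolding subset_eq using assms sets_mem_cluster by (intro sets.sets_Collect_finite_All) auto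

lemma sets_tail:
  assumes p: "0 \<le> p" "p \<le> 1"
  shows "{\<omega> \<in> space (percolation_law I p). enat n \<le> set_size (C (opened I \<omega>))} \<in> sets (percolation_law I p)"
proof -
  let ?X = "{X. finite X \<and> X \<subseteq> V \<and> card X = n}"
  have "{\<omega> \<in> space (percolation_law I p). enat n \<le> set_size (C (opened I \<omega>))}
      = (\<Union>X\<in>?X. {\<omega> \<in> space (percolation_law I p). X \<subseteq> C (opened I \<omega>)})"
  proof (intro set_eqI iffI)
    fix \<omega> assume \<omega>: "\<omega> \<in> {\<omega> \<in> space (percolation_law I p). enat n \<le> set_size (C (opened I \<omega>))}"
    then obtain X where "X \<subseteq> C (opened I \<omega>)" "finite X" "card X = n"
      by (auto simp: set_size_ge_iff)
    then show "\<omega> \<in> (\<Union>X\<in>?X. {\<omega> \<in> space (percolation_law I p). X \<subseteq> C (opened I \<omega>)})"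
      using \<omega> cluster_subset[of "opened I \<omega>"] by auto
  qed (auto simp: set_size_ge_iff)
  moreover have "countable ?X"
    using countable_Collect_finite_subset[OF vertices_countable] by (rule countable_subset[rotated]) auto
  ultimately show ?thesis
    using sets_subset_cluster[OF p] by (auto intro!: sets.countable_UN')
qed

lemma sets_not_subset:
  assumes p: "0 \<le> p" "p \<le> 1"
  shows "{\<omega> \<in> space (percolation_law I p). \<not> C (opened I \<omega>) \<subseteq> L} \<in> sets (percolation_law I p)"
proof -
  have "{\<omega> \<in> space (percolation_law I p). \<not> C (opened I \<omega>) \<subseteq> L}
      = (\<Union>w\<in>V - L. {\<omega> \<in> space (percolation_law I p). w \<in> C (opened I \<omega>)})"
    using cluster_subset by blast
  then show ?thesis
    using sets_mem_cluster[OF p] vertices_countable by (auto intro!: sets.countable_UN')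
qed

text \<open>Any \<open>n\<close> vertices of the cluster are witnessed by finitely many open items,
  which all lie in some \<open>K k\<close>. So the finite-volume events increase to the tail event,
  and bounds proved for \<open>bexp\<close> pass to the measure.\<close>

lemma tail_limit:
  assumes p: "0 \<le> p" "p \<le> 1"
    and K: "\<And>k. finite (K k)" "\<And>k. K k \<subseteq> I" "incseq K" "(\<Union>k. K k) = I"
  shows "(\<lambda>k. bexp (K k) p (\<lambda>B. of_bool (enat n \<le> set_size (C B)))) \<longlonglongrightarrow>
    measure (percolation_law I p) {\<omega> \<in> space (percolation_law I p). enat n \<le> set_size (C (opened I \<omega>))}"
proof -
  interpret prob_space "percolation_law I p" by (rule prob_space_percolation_law)
  let ?A = "\<lambda>k. {\<omega> \<in> space (percolation_law I p). enat n \<le> set_size (C (opened I \<omega> \<inter> K k))}"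
  have le: "set_size (C (opened I \<omega> \<inter> K k)) \<le> set_size (C (opened I \<omega> \<inter> X))" if "K k \<subseteq> X" for k \<omega> X
    using that by (intro set_size_mono cluster_mono) auto
  have "{\<omega> \<in> space (percolation_law I p). enat n \<le> set_size (C (opened I \<omega>))} = (\<Union>k. ?A k)"
  proof safe
    fix \<omega> assume \<omega>: "\<omega> \<in> space (percolation_law I p)" "enat n \<le> set_size (C (opened I \<omega>))"
    then obtain X where X: "X \<subseteq> C (opened I \<omega>)" "finite X" "card X = n"
      by (auto simp: set_size_ge_iff)
    then have "\<forall>w\<in>X. \<exists>F. F \<subseteq> opened I \<omega> \<and> finite F \<and> w \<in> C F"
      using cluster_finitary by blast
    then obtain F where F: "\<And>w. w \<in> X \<Longrightarrow> F w \<subseteq> opened I \<omega> \<and> finite (F w) \<and> w \<in> C (F w)"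
      by (auto dest!: bchoice)
    have "finite (\<Union>w\<in>X. F w)" "(\<Union>w\<in>X. F w) \<subseteq> (\<Union>k. K k)"
      using F X(2) K(4) by (auto simp: opened_def)
    then obtain k where "(\<Union>w\<in>X. F w) \<subseteq> K k"
      using finite_subset_incseq_UN K(3) by metis
    then have "F w \<subseteq> opened I \<omega> \<inter> K k" if "w \<in> X" for w
      using F that by blast
    then have "X \<subseteq> C (opened I \<omega> \<inter> K k)"
      using F cluster_mono by blast
    then show "\<omega> \<in> (\<Union>k. ?A k)" using \<omega> X by (auto simp: set_size_ge_iff)
  next
    fix \<omega> k assume "enat n \<le> set_size (C (opened I \<omega> \<inter> K k))"
    then show "enat n \<le> set_size (C (opened I \<omega>))"
      using set_size_mono[OF cluster_mono, of "opened I \<omega> \<inter> K k" "opened I \<omega>"] by auto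
  qed
  moreover have "range ?A \<subseteq> sets (percolation_law I p)"
    using percolation_law_finite(1)[OF K(1,2) p, where P = "\<lambda>B. enat n \<le> set_size (C B)"] by auto
  moreover have "incseq ?A"
  proof (rule incseq_SucI)
    fix k
    show "?A k \<subseteq> ?A (Suc k)"
      using le[of k "K (Suc k)"] K(3) order_trans by (fastforce dest: incseq_SucD)
  qed
  ultimately have "(\<lambda>k. measure (percolation_law I p) (?A k)) \<longlonglongrightarrow>
      measure (percolation_law I p) {\<omega> \<in> space (percolation_law I p). enat n \<le> set_size (C (opened I \<omega>))}"
    using finite_Lim_measure_incseq[of ?A] by simp
  then show ?thesis
    using percolation_law_finite(2)[OF K(1,2) p, where P = "\<lambda>B. enat n \<le> set_size (C B)"] by simp
qed

definition tail :: "real \<Rightarrow> nat \<Rightarrow> real" where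
  "tail p n = measure (percolation_law I p)
    {\<omega> \<in> space (percolation_law I p). enat n \<le> set_size (C (opened I \<omega>))}"

lemma tail_le_bexp:
  assumes p: "0 \<le> p" "p \<le> 1"
    and "\<And>J. finite J \<Longrightarrow> J \<subseteq> I \<Longrightarrow> bexp J p (\<lambda>B. of_bool (enat n \<le> set_size (C B))) \<le> c"
  shows "tail p n \<le> c"
proof -
  obtain K where K: "\<And>k. finite (K k)" "\<And>k. K k \<subseteq> I" "incseq K" "(\<Union>k::nat. K k) = I"
    using countable_exhaustion[OF items_countable] by metis
  show ?thesis
    unfolding tail_def using assms(3) K(1,2)
    by (intro LIMSEQ_le_const2[OF tail_limit[OF p K, of n]]) blast
qed

lemma tail_mono:
  assumes "0 \<le> p" "p \<le> q" "q \<le> 1"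
  shows "tail p n \<le> tail q n"
proof -
  obtain K where K: "\<And>k. finite (K k)" "\<And>k. K k \<subseteq> I" "incseq K" "(\<Union>k::nat. K k) = I"
    using countable_exhaustion[OF items_countable] by metis
  have mono: "mono (\<lambda>B. of_bool (enat n \<le> set_size (C B)) :: real)"
    using set_size_mono[OF cluster_mono] by (intro monoI) (auto intro: order_trans)
  show ?thesis
    unfolding tail_def
  proof (rule LIMSEQ_le)
    show "\<exists>N. \<forall>k\<ge>N. bexp (K k) p (\<lambda>B. of_bool (enat n \<le> set_size (C B)))
        \<le> (bexp (K k) q (\<lambda>B. of_bool (enat n \<le> set_size (C B))) :: real)"
      using bexp_mono_param[OF assms K(1) mono] by auto
  qed (use tail_limit K assms in auto)
qed

text \<open>A cluster is infinite iff it leaves every member of a finite exhaustion of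
  \<open>V\<close>, and these events decrease. Further open items cannot undo leaving, so a bound
  obtained with finitely many items suffices.\<close>

lemma infinite_cluster_probability_ge:
  assumes q: "0 \<le> q" "q \<le> 1"
    and escape: "\<And>L. finite L \<Longrightarrow> L \<subseteq> V \<Longrightarrow>
      \<exists>J\<subseteq>I. finite J \<and> c \<le> bexp J q (\<lambda>B. of_bool (\<not> C B \<subseteq> L))"
  shows "c \<le> measure (percolation_law I q)
    {\<omega> \<in> space (percolation_law I q). set_size (C (opened I \<omega>)) = \<infinity>}"
proof -
  interpret prob_space "percolation_law I q" by (rule prob_space_percolation_law)
  obtain L where L: "\<And>k. finite (L k)" "\<And>k. L k \<subseteq> V" "incseq L" "(\<Union>k::nat. L k) = V"
    using countable_exhaustion[OF vertices_countable] by metis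
  let ?U = "\<lambda>k. {\<omega> \<in> space (percolation_law I q). \<not> C (opened I \<omega>) \<subseteq> L k}"
  have "{\<omega> \<in> space (percolation_law I q). set_size (C (opened I \<omega>)) = \<infinity>} = (\<Inter>k. ?U k)"
  proof safe
    fix \<omega> k assume "set_size (C (opened I \<omega>)) = \<infinity>" "C (opened I \<omega>) \<subseteq> L k"
    then show False using L(1) finite_subset by (auto simp: set_size_def split: if_splits)
  next
    fix \<omega> assume \<omega>: "\<omega> \<in> (\<Inter>k. ?U k)"
    then show "set_size (C (opened I \<omega>)) = \<infinity>"
      using finite_subset_incseq_UN[of "C (opened I \<omega>)" L] cluster_subset L
      by (auto simp: set_size_def)
  qed auto
  moreover have "range ?U \<subseteq> sets (percolation_law I q)"
    using sets_not_subset[OF q] by auto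
  moreover have "decseq ?U"
    using L(3) by (auto simp: decseq_def incseq_def)
  ultimately have lim: "(\<lambda>k. measure (percolation_law I q) (?U k)) \<longlonglongrightarrow> measure (percolation_law I q)
      {\<omega> \<in> space (percolation_law I q). set_size (C (opened I \<omega>)) = \<infinity>}"
    using finite_Lim_measure_decseq[of ?U] by simp
  have "c \<le> measure (percolation_law I q) (?U k)" for k
  proof -
    obtain J where J: "J \<subseteq> I" "finite J" "c \<le> bexp J q (\<lambda>B. of_bool (\<not> C B \<subseteq> L k))"
      using escape[OF L(1,2)] by blast
    have "bexp J q (\<lambda>B. of_bool (\<not> C B \<subseteq> L k))
        = measure (percolation_law I q) {\<omega> \<in> space (percolation_law I q). \<not> C (opened I \<omega> \<inter> J) \<subseteq> L k}"
      using percolation_law_finite(2)[OF J(2,1) q, of "\<lambda>B. \<not> C B \<subseteq> L k"] by simp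
    also have "\<dots> \<le> measure (percolation_law I q) (?U k)"
      using sets_not_subset[OF q] cluster_mono[OF Int_lower1]
      by (intro finite_measure_mono) blast+
    finally show ?thesis using J by simp
  qed
  then show ?thesis using lim by (intro LIMSEQ_le_const) auto
qed

end

text \<open>The factor \<open>a\<close> allows for a cluster that is empty although open paths lead
  away from \<open>x0\<close>: a vacant \<open>x0\<close> in site percolation. It may depend on
  \<open>q\<close> but not on \<open>L\<close>, so the lower bound survives as \<open>L\<close>
  grows.\<close>

locale item_cluster = item_graph V E I r + cluster_model V I C
  for V :: "'a set" and E :: "'a set set" and I :: "'i set" and r :: "'a \<Rightarrow> 'a \<Rightarrow> 'i"
    and C :: "'i set \<Rightarrow> 'a set" +
  fixes x0 :: 'a
  assumes x0: "x0 \<in> V"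
    and cluster_reach: "C B \<subseteq> reach B {x0}"
    and escape_cluster: "0 < (q :: real) \<Longrightarrow> q \<le> 1 \<Longrightarrow> \<exists>a>0. \<forall>L. finite L \<longrightarrow> x0 \<in> L \<longrightarrow>
      (\<exists>J\<subseteq>I. finite J \<and> out_items L \<subseteq> J \<and>
        a * bexp J q (\<lambda>B. of_bool (x0 \<in> escape L B)) \<le> bexp J q (\<lambda>B. of_bool (\<not> C B \<subseteq> L)))"
begin

section \<open>Exponential tails below the critical parameter\<close>

definition no_percolation :: "real set" where
  "no_percolation = {p \<in> {0..1}. measure (percolation_law I p)
    {\<omega> \<in> space (percolation_law I p). set_size (C (opened I \<omega>)) = \<infinity>} = 0}"

text \<open>Keeps the supremum from being taken over the empty set. At parameter 0 every item is
  closed, so the cluster has at most one vertex.\<close>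

lemma zero_no_percolation: "0 \<in> no_percolation"
proof -
  interpret prob_space "percolation_law I 0" by (rule prob_space_percolation_law)
  have "C {} \<subseteq> {x0}" using cluster_reach[of "{}"] by (auto simp: reach_def arcs_def)
  then have "card (C {}) \<le> 1" "finite (C {})" 
    using card_mono[of "{x0}" "C {}"] finite_subset[of "C {}" "{x0}"] by simp_all
  then have "\<not> enat 2 \<le> set_size (C {})" by (simp add: set_size_def)
  then have "tail 0 2 \<le> 0" by (intro tail_le_bexp) (auto simp: bexp_zero)
  moreover have "measure (percolation_law I 0)
      {\<omega> \<in> space (percolation_law I 0). set_size (C (opened I \<omega>)) = \<infinity>} \<le> tail 0 2"
    unfolding tail_def using sets_tail[of 0] by (intro finite_measure_mono) auto
  ultimately show ?thesis
    by (auto simp: no_percolation_def intro: antisym measure_nonneg)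
qed

lemma small_boundary_of_no_percolation:
  assumes q: "q \<in> no_percolation" and p: "0 \<le> p" "p < q"
  shows "\<exists>S t. finite S \<and> S \<subseteq> V \<and> x0 \<in> S \<and> p < t \<and> t < q \<and>
    bexp (inner_items S) t (\<lambda>B. real (card (bdry S B x0))) < 1"
proof (rule ccontr)
  assume contra: "\<not> ?thesis"
  have q1: "0 < q" "q \<le> 1" using q p by (auto simp: no_percolation_def)
  obtain a where a: "a > 0" "\<And>L. finite L \<Longrightarrow> x0 \<in> L \<Longrightarrow>
      (\<exists>J\<subseteq>I. finite J \<and> out_items L \<subseteq> J \<and>
        a * bexp J q (\<lambda>B. of_bool (x0 \<in> escape L B)) \<le> bexp J q (\<lambda>B. of_bool (\<not> C B \<subseteq> L)))"
    using escape_cluster[OF q1] by blast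
  \<comment> \<open>The loss \<open>a\<close> between escape and cluster, times the bound from the
    differential inequality on (p, q); positive because \<open>p < q\<close>.\<close>
  let ?c = "a * (1 - exp (- (q - p)))"
  have "?c \<le> measure (percolation_law I q)
      {\<omega> \<in> space (percolation_law I q). set_size (C (opened I \<omega>)) = \<infinity>}"
  proof (rule infinite_cluster_probability_ge)
    fix L assume L: "finite L" "L \<subseteq> V"
    \<comment> \<open>The factor \<open>a\<close> is available only for sets containing
      \<open>x0\<close>; leaving the larger set implies leaving \<open>L\<close>.\<close>
    let ?L = "insert x0 L"
    obtain J where J: "J \<subseteq> I" "finite J" "out_items ?L \<subseteq> J"
        "a * bexp J q (\<lambda>B. of_bool (x0 \<in> escape ?L B)) \<le> bexp J q (\<lambda>B. of_bool (\<not> C B \<subseteq> ?L))"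
      using a(2)[of ?L] L by auto
    have "1 - exp (- (q - p)) \<le> bexp J q (\<lambda>B. of_bool (x0 \<in> escape ?L B))"
    proof (rule escape_probability_ge[OF p(1,2) q1(2) _ J(2,3)])
      fix S t assume "S \<subseteq> ?L" "x0 \<in> S" "p < t" "t < q"
      moreover from this have "finite S" "S \<subseteq> V" using L x0 finite_subset by auto
      ultimately show "1 \<le> bexp (inner_items S) t (\<lambda>B. real (card (bdry S B x0)))"
        using contra by (meson not_le)
    qed (use L in auto)
    then have "?c \<le> a * bexp J q (\<lambda>B. of_bool (x0 \<in> escape ?L B))"
      using a(1) by (intro mult_left_mono) auto
    also have "\<dots> \<le> bexp J q (\<lambda>B. of_bool (\<not> C B \<subseteq> ?L))" by (rule J)
    also have "\<dots> \<le> bexp J q (\<lambda>B. of_bool (\<not> C B \<subseteq> L))"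
      using q1 by (intro bexp_mono) auto
    finally show "\<exists>J\<subseteq>I. finite J \<and> ?c \<le> bexp J q (\<lambda>B. of_bool (\<not> C B \<subseteq> L))"
      using J by blast
  qed (use q1 in auto)
  also have "\<dots> = 0" using q by (simp add: no_percolation_def)
  finally show False using a(1) p by (simp add: mult_le_0_iff)
qed

lemma exponential_tail:
  assumes p: "0 \<le> p" "p < Sup no_percolation" and trans: "items_transitive_from x0"
  shows "\<exists>c>0. eventually (\<lambda>n. tail p n \<le> exp (- (c * real n))) sequentially"
proof -
  obtain q where q: "q \<in> no_percolation" "p < q"
    using less_cSupD[of no_percolation p] zero_no_percolation p by auto
  then obtain S t where S: "finite S" "S \<subseteq> V" "x0 \<in> S" "p < t" "t < q"
      "bexp (inner_items S) t (\<lambda>B. real (card (bdry S B x0))) < 1"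
    using small_boundary_of_no_percolation[OF _ p(1)] by blast
  have t: "0 \<le> t" "t \<le> 1" using p S q by (auto simp: no_percolation_def)
  obtain K T where KT: "K > 1" "T > 1" "\<And>J. finite J \<Longrightarrow> bexp J t (\<lambda>B. T ^ card (reach B {x0})) \<le> K"
    using exp_moment_of_small_boundary[OF t S(1-3,6) trans] by blast
  \<comment> \<open>Markov's inequality for \<open>T ^ card (reach B {x0})\<close> at the larger
    parameter \<open>t\<close>, where the moment is bounded; monotonicity brings the estimate down
    to \<open>p\<close>.\<close>
  have "tail p n \<le> K / T ^ n" for n
  proof -
    have "tail p n \<le> tail t n" using p S t by (intro tail_mono) auto
    also have "\<dots> \<le> K / T ^ n"
    proof (rule tail_le_bexp[OF t])
      fix J assume J: "finite J" "J \<subseteq> I"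
      have "bexp J t (\<lambda>B. of_bool (enat n \<le> set_size (C B))) \<le> bexp J t (\<lambda>B. 1 / T ^ n * T ^ card (reach B {x0}))"
      proof (rule bexp_mono[OF t])
        fix B assume "B \<subseteq> J"
        then have fin: "finite (reach B {x0})" 
          using finite_reach finite_subset[OF _ J(1)] by simp
        show "of_bool (enat n \<le> set_size (C B)) \<le> 1 / T ^ n * T ^ card (reach B {x0})"
        proof (cases "enat n \<le> set_size (C B)")
          case True
          then have "enat n \<le> set_size (reach B {x0})"
            using set_size_mono[OF cluster_reach] order_trans by blast
          then have "n \<le> card (reach B {x0})" using fin by (simp add: set_size_def)
          then have "T ^ n \<le> T ^ card (reach B {x0})" using KT by (intro power_increasing) auto
          then show ?thesis using KT by (simp add: field_simps)
        qed (use KT in auto)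
      qed
      also have "\<dots> = 1 / T ^ n * bexp J t (\<lambda>B. T ^ card (reach B {x0}))" by (rule bexp_cmult)
      also have "\<dots> \<le> 1 / T ^ n * K" using KT J by (intro mult_left_mono) auto
      finally show "bexp J t (\<lambda>B. of_bool (enat n \<le> set_size (C B))) \<le> K / T ^ n" by simp
    qed
    finally show ?thesis .
  qed
  \<comment> \<open>Half of the rate \<open>ln T\<close> is given up to absorb the constant
    \<open>K\<close>.\<close>
  moreover have "eventually (\<lambda>n. K / T ^ n \<le> exp (- (ln T / 2 * real n))) sequentially"
  proof -
    have "filterlim (\<lambda>n. exp (ln T / 2 * real n)) at_top sequentially"
      using KT
      by (intro filterlim_compose[OF exp_at_top] filterlim_tendsto_pos_mult_at_top[OF tendsto_const]
          filterlim_real_sequentially) auto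
    then have "eventually (\<lambda>n. K \<le> exp (ln T / 2 * real n)) sequentially"
      by (simp add: filterlim_at_top)
    then show ?thesis
    proof eventually_elim
      case (elim n)
      have "T ^ n = exp (ln T / 2 * real n) * exp (ln T / 2 * real n)"
        using KT by (simp add: exp_of_nat_mult flip: exp_add)
      then show ?case using elim by (simp add: exp_minus field_simps)
    qed
  qed
  ultimately show ?thesis
    using KT by (intro exI[of _ "ln T / 2"]) (auto elim!: eventually_mono intro: order_trans)
qed

end

section \<open>Analyticity from exponential tails\<close>

text \<open>For the empty set the bound \<open>d * card A\<close> would permit no item at all,
  although the state of the root decides whether a site cluster is empty. The empty cluster adds
  nothing to the mean size.\<close>

locale local_cluster = cluster_model V I C
  for V :: "'a set" and I :: "'i set" and C :: "'i set \<Rightarrow> 'a set" +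
  fixes d :: nat
  assumes vertices_infinite: "infinite V"
    and cluster_local: "finite A \<Longrightarrow> A \<noteq> {} \<Longrightarrow> A \<subseteq> V \<Longrightarrow>
      \<exists>J\<subseteq>I. finite J \<and> card J \<le> d * card A \<and> (\<forall>B B'. B \<inter> J = B' \<inter> J \<longrightarrow> C B = A \<longrightarrow> C B' = A)"
begin

definition finite_parts :: "'a set set" where
  "finite_parts = {A. finite A \<and> A \<noteq> {} \<and> A \<subseteq> V}"

definition deciding_items :: "'a set \<Rightarrow> 'i set" where
  "deciding_items A = (SOME J. J \<subseteq> I \<and> finite J \<and> card J \<le> d * card A \<and>
    (\<forall>B B'. B \<inter> J = B' \<inter> J \<longrightarrow> C B = A \<longrightarrow> C B' = A))"

text \<open>The probability of the event \<open>C = A\<close> as a polynomial, to be evaluated at complex arguments.\<close>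

definition cluster_poly :: "'a set \<Rightarrow> 'b::comm_ring_1 \<Rightarrow> 'b" where
  "cluster_poly A z = bexp (deciding_items A) z (\<lambda>B. of_bool (C B = A))"

lemma deciding_items:
  assumes "A \<in> finite_parts"
  shows "deciding_items A \<subseteq> I" "finite (deciding_items A)" "card (deciding_items A) \<le> d * card A"
    and "C (B \<inter> deciding_items A) = A \<longleftrightarrow> C B = A"
proof -
  have "\<exists>J. J \<subseteq> I \<and> finite J \<and> card J \<le> d * card A \<and> (\<forall>B B'. B \<inter> J = B' \<inter> J \<longrightarrow> C B = A \<longrightarrow> C B' = A)"
    using cluster_local[of A] assms by (auto simp: finite_parts_def)
  from someI_ex[OF this]
  have *: "deciding_items A \<subseteq> I" "finite (deciding_items A)" "card (deciding_items A) \<le> d * card A"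
      "\<And>B B'. B \<inter> deciding_items A = B' \<inter> deciding_items A \<Longrightarrow> C B = A \<Longrightarrow> C B' = A"
    unfolding deciding_items_def by blast+
  show "deciding_items A \<subseteq> I" "finite (deciding_items A)" "card (deciding_items A) \<le> d * card A"
    by (fact *)+
  show "C (B \<inter> deciding_items A) = A \<longleftrightarrow> C B = A"
    using *(4)[of B "B \<inter> deciding_items A"] *(4)[of "B \<inter> deciding_items A" B] by auto
qed

lemma measure_cluster_eq:
  assumes p: "0 \<le> p" "p \<le> 1" and A: "A \<in> finite_parts"
  shows "{\<omega> \<in> space (percolation_law I p). C (opened I \<omega>) = A} \<in> sets (percolation_law I p)"
    and "measure (percolation_law I p) {\<omega> \<in> space (percolation_law I p). C (opened I \<omega>) = A} = cluster_poly A p"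
  using percolation_law_finite[OF deciding_items(2,1)[OF A] p, where P = "\<lambda>B. C B = A"]
    deciding_items(4)[OF A] by (simp_all add: cluster_poly_def)

lemma cluster_poly_nonneg:
  fixes p :: real
  assumes "0 \<le> p" "p \<le> 1"
  shows "0 \<le> cluster_poly A p"
  using assms unfolding cluster_poly_def bexp_def by (intro sum_nonneg) auto

lemma cluster_poly_of_real: "cluster_poly A (complex_of_real p) = complex_of_real (cluster_poly A p)"
  by (simp add: cluster_poly_def bexp_def of_bool_def if_distrib cong: if_cong)

lemma holomorphic_cluster_poly: "cluster_poly A holomorphic_on S"
  unfolding cluster_poly_def[abs_def] bexp_def by (intro holomorphic_intros)

text \<open>Termwise comparison with coefficients 0 and 1: an open item costs nothing, a closed one
  at most \<open>M\<close>, and at most \<open>d * card A\<close> items are involved.\<close>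

lemma norm_cluster_poly_le:
  fixes z :: complex
  assumes A: "A \<in> finite_parts" and p: "0 \<le> p" "p \<le> 1" and M: "1 \<le> M"
    and z: "norm z \<le> p" "norm (1 - z) \<le> M * (1 - p)"
  shows "norm (cluster_poly A z) \<le> (M ^ d) ^ card A * cluster_poly A p"
proof -
  let ?J = "deciding_items A"
  have "norm (cluster_poly A z)
      \<le> (\<Sum>B\<in>Pow ?J. norm (z ^ card B * (1 - z) ^ card (?J - B) * of_bool (C B = A)))"
    unfolding cluster_poly_def bexp_def by (rule norm_sum)
  also have "\<dots> \<le> (\<Sum>B\<in>Pow ?J. M ^ (d * card A) * (p ^ card B * (1 - p) ^ card (?J - B) * of_bool (C B = A)))"
  proof (intro sum_mono)
    fix B assume "B \<in> Pow ?J"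
    have "card (?J - B) \<le> card ?J" using deciding_items(2)[OF A] by (intro card_mono) auto
    then have le: "card (?J - B) \<le> d * card A" using deciding_items(3)[OF A] by simp
    have "norm z ^ card B * norm (1 - z) ^ card (?J - B) \<le> p ^ card B * (M * (1 - p)) ^ card (?J - B)"
      using z p by (intro mult_mono power_mono) auto
    also have "\<dots> = M ^ card (?J - B) * (p ^ card B * (1 - p) ^ card (?J - B))"
      by (simp add: power_mult_distrib)
    also have "\<dots> \<le> M ^ (d * card A) * (p ^ card B * (1 - p) ^ card (?J - B))"
      using M p le by (intro mult_right_mono power_increasing) auto
    finally show "norm (z ^ card B * (1 - z) ^ card (?J - B) * of_bool (C B = A))
        \<le> M ^ (d * card A) * (p ^ card B * (1 - p) ^ card (?J - B) * of_bool (C B = A))"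
      by (auto simp: norm_mult norm_power)
  qed
  also have "\<dots> = (M ^ d) ^ card A * cluster_poly A p"
    by (simp add: cluster_poly_def bexp_def sum_distrib_left power_mult)
  finally show ?thesis .
qed

section \<open>Series over the possible finite clusters\<close>

lemma sum_cluster_poly_le_tail:
  assumes p: "0 \<le> p" "p \<le> 1" and F: "finite F" "F \<subseteq> finite_parts" "\<And>A. A \<in> F \<Longrightarrow> card A = n"
  shows "(\<Sum>A\<in>F. cluster_poly A p) \<le> tail p n"
proof -
  interpret prob_space "percolation_law I p" by (rule prob_space_percolation_law)
  let ?S = "\<lambda>A. {\<omega> \<in> space (percolation_law I p). C (opened I \<omega>) = A}"
  have "(\<Sum>A\<in>F. cluster_poly A p) = (\<Sum>A\<in>F. measure (percolation_law I p) (?S A))"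
    using measure_cluster_eq(2)[OF p] F by (intro sum.cong) auto
  also have "\<dots> = measure (percolation_law I p) (\<Union>A\<in>F. ?S A)"
    using measure_cluster_eq(1)[OF p] F
    by (intro finite_measure_finite_Union[symmetric]) (auto simp: disjoint_family_on_def)
  also have "\<dots> \<le> tail p n"
    unfolding tail_def
  proof (intro finite_measure_mono sets_tail[OF p])
    show "(\<Union>A\<in>F. ?S A) \<subseteq> {\<omega> \<in> space (percolation_law I p). enat n \<le> set_size (C (opened I \<omega>))}"
      using F by (fastforce simp: finite_parts_def set_size_def)
  qed
  finally show ?thesis .
qed

text \<open>Group the sets by size: those of size \<open>n\<close> describe disjoint events, all
  contained in the event of a cluster with at least \<open>n\<close> vertices.\<close>

lemma sum_weighted_cluster_poly_le:
  assumes p: "0 \<le> p" "p \<le> 1" and F: "finite F" "F \<subseteq> finite_parts" and f: "\<And>n. 0 \<le> f n"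
    and summ: "summable (\<lambda>n. f n * tail p n)"
  shows "(\<Sum>A\<in>F. f (card A) * cluster_poly A p) \<le> (\<Sum>n. f n * tail p n)"
proof -
  have "(\<Sum>A\<in>F. f (card A) * cluster_poly A p)
      = (\<Sum>n\<in>card ` F. \<Sum>A\<in>{A \<in> F. card A = n}. f (card A) * cluster_poly A p)"
    using F by (intro sum.group[symmetric]) auto
  also have "\<dots> = (\<Sum>n\<in>card ` F. f n * (\<Sum>A\<in>{A \<in> F. card A = n}. cluster_poly A p))"
    by (auto simp: sum_distrib_left intro!: sum.cong)
  also have "\<dots> \<le> (\<Sum>n\<in>card ` F. f n * tail p n)"
    using F f by (intro sum_mono mult_left_mono sum_cluster_poly_le_tail[OF p]) auto
  also have "\<dots> \<le> (\<Sum>n. f n * tail p n)"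
    using F f summ by (intro sum_le_suminf) (auto simp: tail_def)
  finally show ?thesis .
qed

definition nth_part :: "nat \<Rightarrow> 'a set" where
  "nth_part = from_nat_into finite_parts"

lemma bij_nth_part: "bij_betw nth_part UNIV finite_parts"
  unfolding nth_part_def
proof (rule bij_betw_from_nat_into)
  show "countable finite_parts"
    using countable_Collect_finite_subset[OF vertices_countable]
    by (rule countable_subset[rotated]) (auto simp: finite_parts_def)
  have "(\<lambda>x. {x}) ` V \<subseteq> finite_parts" by (auto simp: finite_parts_def)
  moreover have "infinite ((\<lambda>x. {x}) ` V)"
    using vertices_infinite by (simp add: finite_image_iff)
  ultimately show "infinite finite_parts" using finite_subset by blast
qed

lemma nth_part_in: "nth_part k \<in> finite_parts"
  using bij_nth_part by (auto simp: bij_betw_def)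

text \<open>Applied with the weight \<open>real n\<close> for the mean size and with
  \<open>real n * exp (c / 2) ^ n\<close> for the majorant on a complex disc.\<close>

lemma summable_cluster_poly:
  assumes p: "0 \<le> p" "p \<le> 1" and f: "\<And>n. 0 \<le> f n" and summ: "summable (\<lambda>n. f n * tail p n)"
  shows "summable (\<lambda>k. f (card (nth_part k)) * cluster_poly (nth_part k) p)"
proof (rule bounded_imp_summable)
  show "0 \<le> f (card (nth_part k)) * cluster_poly (nth_part k) p" for k
    using f cluster_poly_nonneg[OF p] by simp
  fix n
  have inj: "inj_on nth_part {..n}" using bij_nth_part by (auto simp: bij_betw_def intro: inj_on_subset)
  have "(\<Sum>k\<le>n. f (card (nth_part k)) * cluster_poly (nth_part k) p)
      = (\<Sum>A\<in>nth_part ` {..n}. f (card A) * cluster_poly A p)"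
    by (simp add: sum.reindex[OF inj])
  also have "\<dots> \<le> (\<Sum>n. f n * tail p n)"
    using nth_part_in by (intro sum_weighted_cluster_poly_le[OF p _ _ f summ]) auto
  finally show "(\<Sum>k\<le>n. f (card (nth_part k)) * cluster_poly (nth_part k) p) \<le> (\<Sum>n. f n * tail p n)" .
qed

lemma nn_integral_cluster_size:
  assumes p: "0 \<le> p" "p \<le> 1" and tail: "tail p \<longlonglongrightarrow> 0"
    and summ: "summable (\<lambda>n. real n * tail p n)"
  shows "(\<integral>\<^sup>+ \<omega>. ennreal_of_enat (set_size (C (opened I \<omega>))) \<partial>percolation_law I p)
    = ennreal (\<Sum>k. real (card (nth_part k)) * cluster_poly (nth_part k) p)"
proof -
  interpret prob_space "percolation_law I p" by (rule prob_space_percolation_law)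
  let ?L = "percolation_law I p"
  let ?S = "\<lambda>k. {\<omega> \<in> space ?L. C (opened I \<omega>) = nth_part k}"
  let ?f = "\<lambda>k \<omega>. ennreal (real (card (nth_part k))) * indicator (?S k) \<omega>"
  \<comment> \<open>The series over finite sets does not see infinite clusters; the vanishing tail
    makes them a null event.\<close>
  have fin: "AE \<omega> in ?L. finite (C (opened I \<omega>))"
  proof -
    let ?N = "\<lambda>n. {\<omega> \<in> space ?L. enat n \<le> set_size (C (opened I \<omega>))}"
    have "(\<lambda>n. emeasure ?L (?N n)) \<longlonglongrightarrow> 0"
      using tail tendsto_ennrealI[of "tail p" 0] by (simp add: tail_def emeasure_eq_measure)
    moreover have "emeasure ?L (\<Inter>n. ?N n) \<le> emeasure ?L (?N n)" for n
      using sets_tail[OF p] by (intro emeasure_mono) auto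
    ultimately have "emeasure ?L (\<Inter>n. ?N n) \<le> 0"
      by (intro LIMSEQ_le_const) auto
    then have "(\<Inter>n. ?N n) \<in> null_sets ?L"
      using sets_tail[OF p] by (auto simp: null_sets_def)
    moreover have "\<omega> \<in> (\<Inter>n. ?N n)" if "\<omega> \<in> space ?L" "infinite (C (opened I \<omega>))" for \<omega>
      using that by (auto simp: set_size_def)
    ultimately show ?thesis by (intro AE_I'[of "\<Inter>n. ?N n"]) auto
  qed
  have "(\<integral>\<^sup>+ \<omega>. ennreal_of_enat (set_size (C (opened I \<omega>))) \<partial>?L) = (\<integral>\<^sup>+ \<omega>. (\<Sum>k. ?f k \<omega>) \<partial>?L)"
  proof (rule nn_integral_cong_AE)
    show "AE \<omega> in ?L. ennreal_of_enat (set_size (C (opened I \<omega>))) = (\<Sum>k. ?f k \<omega>)"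
      using fin AE_space
    proof eventually_elim
      case (elim \<omega>)
      show ?case
      proof (cases "C (opened I \<omega>) = {}")
        case True
        then have "?f k \<omega> = 0" for k
          using nth_part_in[of k] by (auto simp: finite_parts_def indicator_def)
        then have "(\<Sum>k. ?f k \<omega>) = 0" by (simp only: suminf_zero)
        then show ?thesis using True by (simp add: set_size_def zero_enat_def[symmetric])
      next
        case False
        then have "C (opened I \<omega>) \<in> finite_parts"
          using elim cluster_subset by (auto simp: finite_parts_def)
        then obtain k where k: "C (opened I \<omega>) = nth_part k" using bij_nth_part by (auto simp: bij_betw_def)
        have "?f j \<omega> = 0" if "j \<noteq> k" for j
          using that k bij_nth_part by (auto simp: indicator_def bij_betw_def inj_on_def)
        then have "(\<Sum>k. ?f k \<omega>) = (\<Sum>j\<in>{k}. ?f j \<omega>)"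
          by (intro suminf_finite) auto
        then show ?thesis using elim k by (simp add: set_size_def ennreal_of_nat_eq_real_of_nat)
      qed
    qed
  qed
  also have "\<dots> = (\<Sum>k. \<integral>\<^sup>+ \<omega>. ?f k \<omega> \<partial>?L)"
    using measure_cluster_eq(1)[OF p nth_part_in]
    by (intro nn_integral_suminf borel_measurable_times_ennreal borel_measurable_const borel_measurable_indicator)
  also have "\<dots> = (\<Sum>k. ennreal (real (card (nth_part k)) * cluster_poly (nth_part k) p))"
    using measure_cluster_eq[OF p nth_part_in] cluster_poly_nonneg[OF p]
    by (simp add: nn_integral_cmult emeasure_eq_measure ennreal_mult)
  also have "\<dots> = ennreal (\<Sum>k. real (card (nth_part k)) * cluster_poly (nth_part k) p)"
    using summable_cluster_poly[OF p _ summ] cluster_poly_nonneg[OF p]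
    by (intro suminf_ennreal2) auto
  finally show ?thesis .
qed

text \<open>The decay exp (-c n) is split into two factors \<rho>^n with \<rho> = exp (-c/2): one
  cancels the weight \<open>exp (c / 2) ^ n\<close>, the other makes the series converge. The rate
  found at \<open>q\<close> is inherited by every \<open>p\<close> below it.\<close>

lemma summable_exp_tail:
  assumes c: "c > 0" and ev: "eventually (\<lambda>n. tail q n \<le> exp (- (c * real n))) sequentially"
    and p: "0 \<le> p" "p \<le> q" "q \<le> 1"
  shows "summable (\<lambda>n. real n * exp (c / 2) ^ n * tail p n)"
proof -
  define \<rho> where "\<rho> = exp (- (c / 2))"
  have "0 < \<rho>" "\<rho> < 1" using c by (auto simp: \<rho>_def)
  have "summable (\<lambda>n. real (Suc n) * \<rho> ^ n)"
    using geometric_deriv_sums[of \<rho>] \<open>0 < \<rho>\<close> \<open>\<rho> < 1\<close> by (auto simp: sums_iff)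
  moreover have "eventually (\<lambda>n. norm (real n * exp (c / 2) ^ n * tail p n) \<le> real (Suc n) * \<rho> ^ n) sequentially"
    using ev
  proof eventually_elim
    case (elim n)
    have nonneg: "0 \<le> tail p n" by (simp add: tail_def)
    have "tail p n \<le> exp (- (c * real n))" using elim tail_mono[OF p, of n] by simp
    also have "\<dots> = \<rho> ^ n * \<rho> ^ n"
      by (simp add: \<rho>_def exp_of_nat_mult[symmetric] exp_add[symmetric])
    finally have "exp (c / 2) ^ n * tail p n \<le> exp (c / 2) ^ n * (\<rho> ^ n * \<rho> ^ n)"
      by (intro mult_left_mono) auto
    also have "\<dots> = \<rho> ^ n"
      by (simp add: \<rho>_def exp_minus power_inverse)
    finally have "real n * (exp (c / 2) ^ n * tail p n) \<le> real (Suc n) * \<rho> ^ n"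
      using nonneg \<open>0 < \<rho>\<close> by (intro mult_mono) auto
    then show ?case using nonneg by (simp add: mult.assoc)
  qed
  ultimately show ?thesis by (rule summable_comparison_test_ev[rotated])
qed

lemma tail_tendsto_0:
  assumes c: "c > 0" and ev: "eventually (\<lambda>n. tail q n \<le> exp (- (c * real n))) sequentially"
  shows "tail q \<longlonglongrightarrow> 0"
proof (rule tendsto_sandwich[OF _ ev tendsto_const])
  have "filterlim (\<lambda>n. - (c * real n)) at_bot sequentially"
    unfolding filterlim_uminus_at_bot using c
    by (auto intro!: filterlim_tendsto_pos_mult_at_top[OF tendsto_const] filterlim_real_sequentially)
  then show "(\<lambda>n. exp (- (c * real n))) \<longlonglongrightarrow> 0"
    by (rule filterlim_compose[OF exp_at_bot])
qed (simp add: tail_def)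

theorem analytic_expected_size:
  assumes pc: "pc \<le> 1"
    and decay: "\<And>p. 0 \<le> p \<Longrightarrow> p < pc \<Longrightarrow>
      \<exists>c>0. eventually (\<lambda>n. tail p n \<le> exp (- (c * real n))) sequentially"
  shows "ennreal_analytic_on
    (\<lambda>p. \<integral>\<^sup>+ \<omega>. ennreal_of_enat (set_size (C (opened I \<omega>))) \<partial>percolation_law I p) {0..<pc}"
proof -
  define \<chi>' where "\<chi>' p = (\<Sum>k. real (card (nth_part k)) * cluster_poly (nth_part k) p)" for p :: real
  have size: "(\<integral>\<^sup>+ \<omega>. ennreal_of_enat (set_size (C (opened I \<omega>))) \<partial>percolation_law I p) = ennreal (\<chi>' p)"
    and nonneg: "0 \<le> \<chi>' p" and summ: "summable (\<lambda>k. real (card (nth_part k)) * cluster_poly (nth_part k) p)"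
    if p: "p \<in> {0..<pc}" for p
  proof -
    have p': "0 \<le> p" "p \<le> 1" using p pc by auto
    obtain c where c: "c > 0" "eventually (\<lambda>n. tail p n \<le> exp (- (c * real n))) sequentially"
      using decay[of p] p by auto
    have s: "summable (\<lambda>n. real n * tail p n)"
    proof (rule summable_comparison_test'[OF summable_exp_tail[OF c p'(1) order_refl p'(2)]])
      fix n
      have "1 \<le> exp (c / 2) ^ n" using c by (intro one_le_power) auto
      then have "real n * 1 * tail p n \<le> real n * exp (c / 2) ^ n * tail p n"
        by (intro mult_right_mono mult_left_mono) (auto simp: tail_def)
      then show "norm (real n * tail p n) \<le> real n * exp (c / 2) ^ n * tail p n"
        by (simp add: tail_def)
    qed
    show "(\<integral>\<^sup>+ \<omega>. ennreal_of_enat (set_size (C (opened I \<omega>))) \<partial>percolation_law I p) = ennreal (\<chi>' p)"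
      unfolding \<chi>'_def using nn_integral_cluster_size[OF p' tail_tendsto_0[OF c] s] .
    show summ: "summable (\<lambda>k. real (card (nth_part k)) * cluster_poly (nth_part k) p)"
      by (rule summable_cluster_poly[OF p' _ s]) auto
    show "0 \<le> \<chi>' p"
      unfolding \<chi>'_def using cluster_poly_nonneg[OF p'] by (intro suminf_nonneg summ) auto
  qed
  have "\<exists>\<delta>>0. \<exists>g. g holomorphic_on ball (complex_of_real x) \<delta> \<and>
      (\<forall>y\<in>{0..<pc}. complex_of_real y \<in> ball (complex_of_real x) \<delta> \<longrightarrow> g y = complex_of_real (\<chi>' y))"
    if x: "x \<in> {0..<pc}" for x
  proof -
    \<comment> \<open>The rate \<open>c\<close> at a fixed \<open>q\<close> above \<open>x\<close>
      is valid at all smaller parameters. Fixing it first lets \<delta> depend on \<open>c\<close>;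
      the rate at \<open>x + \<delta>\<close> itself would in turn depend on \<delta>.\<close>
    define q where "q = (x + pc) / 2"
    have q: "x < q" "q < pc" "0 \<le> q" "q \<le> 1" using x pc by (auto simp: q_def)
    obtain c where c: "c > 0" "eventually (\<lambda>n. tail q n \<le> exp (- (c * real n))) sequentially"
      using decay[of q] q by auto
    \<comment> \<open>As the radius shrinks, the cost per vertex tends to 1 and so drops below the
      growth \<open>exp (c / 2)\<close> that the tail can absorb.\<close>
    have "((\<lambda>\<delta>. ((1 - x + \<delta>) / (1 - x - \<delta>)) ^ d) \<longlongrightarrow> ((1 - x + 0) / (1 - x - 0)) ^ d) (at_right 0)"
      using q by (intro tendsto_intros) auto
    then have "((\<lambda>\<delta>. ((1 - x + \<delta>) / (1 - x - \<delta>)) ^ d) \<longlongrightarrow> 1) (at_right 0)" using q by simp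
    then have "eventually (\<lambda>\<delta>. ((1 - x + \<delta>) / (1 - x - \<delta>)) ^ d < exp (c / 2)) (at_right 0)"
      using c by (intro order_tendstoD) auto
    moreover have "eventually (\<lambda>\<delta>. \<delta> \<in> {0<..<q - x}) (at_right 0)"
      using q by (intro eventually_at_right_real) auto
    ultimately have "eventually (\<lambda>\<delta>. ((1 - x + \<delta>) / (1 - x - \<delta>)) ^ d < exp (c / 2) \<and> \<delta> \<in> {0<..<q - x}) (at_right 0)"
      by eventually_elim auto
    then obtain \<delta> where \<delta>: "((1 - x + \<delta>) / (1 - x - \<delta>)) ^ d < exp (c / 2)" "0 < \<delta>" "\<delta> < q - x"
      using eventually_happens[of _ "at_right (0 :: real)"] by auto
    define p where "p = x + \<delta>"
    define M where "M = (1 - x + \<delta>) / (1 - x - \<delta>)"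
    have p: "0 \<le> p" "p \<le> q" "p \<le> 1" "p < 1" using x \<delta> q pc by (auto simp: p_def)
    have "M = (1 - x + \<delta>) / (1 - p)" by (simp add: M_def p_def algebra_simps)
    moreover have "1 - p \<le> 1 - x + \<delta>" using \<delta> by (simp add: p_def)
    ultimately have M: "1 \<le> M" "M * (1 - p) = 1 - x + \<delta>" using p(4) by simp_all
    define m where "m k = real (card (nth_part k)) * exp (c / 2) ^ card (nth_part k) * cluster_poly (nth_part k) p" for k
    define h where "h k z = of_nat (card (nth_part k)) * cluster_poly (nth_part k) z" for k and z :: complex
    have summ_m: "summable m"
      unfolding m_def using summable_exp_tail[OF c p(1,2) q(4)]
      by (intro summable_cluster_poly[OF p(1,3)]) auto
    have bound: "norm (h k z) \<le> m k" if z: "z \<in> ball (complex_of_real x) \<delta>" for k z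
    proof -
      have "norm (z - complex_of_real x) \<le> \<delta>" using z by (simp add: dist_norm norm_minus_commute)
      moreover have "norm z \<le> norm (complex_of_real x) + norm (z - complex_of_real x)"
        by (metis add_diff_cancel_left' diff_add_cancel norm_triangle_ineq add.commute)
      moreover have "norm (1 - z) \<le> norm (complex_of_real (1 - x)) + norm (z - complex_of_real x)"
        using norm_triangle_ineq4[of "complex_of_real (1 - x)" "z - complex_of_real x"] by simp
      moreover have "norm (complex_of_real x) = x" "norm (complex_of_real (1 - x)) = 1 - x"
        using x pc by (auto simp del: of_real_diff)
      ultimately have "norm z \<le> p" "norm (1 - z) \<le> M * (1 - p)" using M(2) by (auto simp: p_def)
      then have "norm (cluster_poly (nth_part k) z) \<le> (M ^ d) ^ card (nth_part k) * cluster_poly (nth_part k) p"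
        using norm_cluster_poly_le[OF nth_part_in p(1,3) M(1)] by blast
      also have "\<dots> \<le> exp (c / 2) ^ card (nth_part k) * cluster_poly (nth_part k) p"
        using \<delta>(1) M(1) cluster_poly_nonneg[OF p(1,3)]
        by (intro mult_right_mono power_mono) (auto simp: M_def)
      finally show ?thesis
        by (simp add: h_def m_def norm_mult mult.assoc mult_left_mono)
    qed
    let ?g = "\<lambda>z. \<Sum>k. h k z"
    have unif: "uniform_limit (ball (complex_of_real x) \<delta>) (\<lambda>n z. \<Sum>k<n. h k z) ?g sequentially"
      using bound summ_m by (rule Weierstrass_m_test)
    have "?g holomorphic_on ball (complex_of_real x) \<delta>"
    proof (rule holomorphic_uniform_sequence)
      show "(\<lambda>z. \<Sum>k<n. h k z) holomorphic_on ball (complex_of_real x) \<delta>" for n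
        unfolding h_def by (intro holomorphic_intros holomorphic_cluster_poly)
      fix z assume "z \<in> ball (complex_of_real x) \<delta>"
      then obtain e where "e > 0" "cball z e \<subseteq> ball (complex_of_real x) \<delta>"
        using open_contains_cball open_ball by metis
      then show "\<exists>e>0. cball z e \<subseteq> ball (complex_of_real x) \<delta> \<and>
          uniform_limit (cball z e) (\<lambda>n z. \<Sum>k<n. h k z) ?g sequentially"
        using uniform_limit_on_subset[OF unif] by blast
    qed auto
    moreover have "?g (complex_of_real y) = complex_of_real (\<chi>' y)" if "y \<in> {0..<pc}" for y
      unfolding \<chi>'_def suminf_of_real[OF summ[OF that]] h_def cluster_poly_of_real by simp
    ultimately show ?thesis using \<delta>(2) by blast
  qed
  then show ?thesis
    using size nonneg unfolding ennreal_analytic_on_def real_analytic_on_def by simp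
qed

end

section \<open>Bond and site percolation\<close>

context item_graph
begin

lemma reach_finitary:
  assumes "w \<in> reach B A"
  shows "\<exists>F\<subseteq>B. finite F \<and> w \<in> reach F A"
proof -
  obtain a where a: "a \<in> A" "(a, w) \<in> (arcs B)\<^sup>*" using assms by (auto simp: reach_def)
  show ?thesis using a(2)
  proof (induction)
    case base
    then show ?case using a(1) by (intro exI[of _ "{}"]) (auto simp: reach_def)
  next
    case (step w w')
    then obtain F where F: "F \<subseteq> B" "finite F" "w \<in> reach F A" by blast
    have "(w, w') \<in> arcs (insert (r w w') F)" using step.hyps by (auto simp: arcs_def)
    moreover have "w \<in> reach (insert (r w w') F) A" using F reach_mono[of F "insert (r w w') F" A] by auto
    ultimately have "w' \<in> reach (insert (r w w') F) A" by (rule reach_step[rotated])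
    moreover have "insert (r w w') F \<subseteq> B" using F step.hyps by (auto simp: arcs_def)
    ultimately show ?case using F by blast
  qed
qed

text \<open>The exploration that yields \<open>D\<close> consults only arcs starting in
  \<open>D\<close>. With bounded degree, the event is thus decided by a number of items linear in
  \<open>card D\<close>.\<close>

lemma reach_determined:
  assumes D: "reach B A = D" and eq: "B \<inter> out_items D = B' \<inter> out_items D"
  shows "reach B' A = D"
proof -
  have arc: "(w, w') \<in> arcs B \<longleftrightarrow> (w, w') \<in> arcs B'" if "w \<in> D" for w w'
    using that eq by (auto simp: arcs_def out_items_def)
  have 1: "w \<in> D" if "(a, w) \<in> (arcs B')\<^sup>*" "a \<in> A" for a w
    using that
  proof (induction)
    case base
    then show ?case using D by (auto simp: reach_def)
  next
    case (step w w')
    then show ?case using arc reach_step D by blast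
  qed
  have 2: "w \<in> D \<and> w \<in> reach B' A" if "(a, w) \<in> (arcs B)\<^sup>*" "a \<in> A" for a w
    using that
  proof (induction)
    case base
    then show ?case using D by (auto simp: reach_def)
  next
    case (step w w')
    then show ?case using arc reach_step D by blast
  qed
  show ?thesis
    using 1 2 D by (auto simp: reach_def)
qed

lemma card_out_items_le: "\<exists>d. \<forall>A. finite A \<longrightarrow> A \<subseteq> V \<longrightarrow> card (out_items A) \<le> d * card A"
proof -
  obtain d where d: "\<And>x. x \<in> V \<Longrightarrow> card {y. {x, y} \<in> E} \<le> d"
    using bounded by (auto simp: bounded_degree_def)
  have "card (out_items A) \<le> d * card A" if "finite A" "A \<subseteq> V" for A
  proof -
    have "out_items A = (\<Union>x\<in>A. r x ` {y. {x, y} \<in> E})" by (auto simp: out_items_def)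
    also have "card \<dots> \<le> (\<Sum>x\<in>A. card (r x ` {y. {x, y} \<in> E}))"
      by (rule card_UN_le[OF that(1)])
    also have "\<dots> \<le> (\<Sum>x\<in>A. d)"
      using that order_trans[OF card_image_le[OF finite_nbrs] d] by (intro sum_mono) blast
    finally show ?thesis by (simp add: mult.commute)
  qed
  then show ?thesis by blast
qed

lemma mem_escape_iff: "x \<in> escape L B \<longleftrightarrow> \<not> reach B {x} \<subseteq> L"
  by (auto simp: escape_def reach_def)

end

text \<open>The cluster exists only if the items in the gate \<open>G\<close> are open: \<open>G = {}\<close> for bond percolation,
  and \<open>G = {x0}\<close> for site percolation, where the state of \<open>x0\<close> does not influence \<open>reach B {x0}\<close>.\<close>

locale gated_item_graph = item_graph V E I r
  for V :: "'a set" and E :: "'a set set" and I :: "'i set" and r :: "'a \<Rightarrow> 'a \<Rightarrow> 'i" +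
  fixes x0 :: 'a and G :: "'i set"
  assumes infinite_V: "infinite V" and countable_I: "countable I"
    and root: "x0 \<in> V"
    and gate: "finite G" "G \<subseteq> I" "card G \<le> 1"
    and reach_gate: "reach (B \<union> G) {x0} = reach B {x0}"
begin

definition cluster :: "'i set \<Rightarrow> 'a set" where
  "cluster B = (if G \<subseteq> B then reach B {x0} else {})"

lemma cluster_determined:
  assumes A: "A \<noteq> {}" and eq: "B \<inter> (G \<union> out_items A) = B' \<inter> (G \<union> out_items A)" and "cluster B = A"
  shows "cluster B' = A"
proof -
  have "G \<subseteq> B" "reach B {x0} = A" using assms by (auto simp: cluster_def split: if_splits)
  moreover have "B \<inter> out_items A = B' \<inter> out_items A" using eq by blast
  moreover have "G \<subseteq> B'" using eq \<open>G \<subseteq> B\<close> by blast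
  ultimately show ?thesis
    using reach_determined[of B "{x0}" A B'] by (simp add: cluster_def)
qed

text \<open>The gate does not influence reachability, so its being open is independent of escape and
  splits off as a factor.\<close>

lemma bexp_gate:
  fixes q :: real
  assumes J: "finite J" "G \<subseteq> J"
  shows "bexp J q (\<lambda>B. of_bool (\<not> cluster B \<subseteq> L)) = q ^ card G * bexp J q (\<lambda>B. of_bool (x0 \<in> escape L B))"
proof -
  have "reach (B - G) {x0} = reach B {x0}" for B
    using reach_gate[of "B - G"] reach_gate[of B] by simp
  then have indep: "bexp J q (\<lambda>B. of_bool (G \<subseteq> B) * of_bool (x0 \<in> escape L B))
      = bexp J q (\<lambda>B. of_bool (G \<subseteq> B)) * bexp J q (\<lambda>B. of_bool (x0 \<in> escape L B))"
    using J by (intro bexp_indep[where K = G]) (auto simp: mem_escape_iff)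
  have "bexp J q (\<lambda>B. of_bool (G \<subseteq> B)) = bexp G q (\<lambda>B. of_bool (G \<subseteq> B))"
    using bexp_restrict[of J "\<lambda>B. of_bool (G \<subseteq> B)" G q] J by (simp add: Int_absorb1)
  also have "\<dots> = (\<Sum>B\<in>{G}. q ^ card B * (1 - q) ^ card (G - B) * of_bool (G \<subseteq> B))"
    unfolding bexp_def using gate by (intro sum.mono_neutral_right) auto
  finally have gate_open: "bexp J q (\<lambda>B. of_bool (G \<subseteq> B)) = q ^ card G" by simp
  have "bexp J q (\<lambda>B. of_bool (\<not> cluster B \<subseteq> L)) = bexp J q (\<lambda>B. of_bool (G \<subseteq> B) * of_bool (x0 \<in> escape L B))"
    by (intro bexp_cong) (simp add: cluster_def mem_escape_iff)
  then show ?thesis unfolding indep gate_open .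
qed

sublocale item_cluster V E I r cluster x0
proof
  show "countable V" "countable I" "x0 \<in> V" by (fact countable_V countable_I root)+
  show "cluster B \<subseteq> V" for B using reach_subset_V[of "{x0}" B] root by (auto simp: cluster_def)
  show "cluster B \<subseteq> cluster B'" if "B \<subseteq> B'" for B B'
    using that reach_mono[OF that] by (auto simp: cluster_def)
  show "\<exists>F\<subseteq>B. finite F \<and> w \<in> cluster F" if "w \<in> cluster B" for w B
  proof -
    have w: "G \<subseteq> B" "w \<in> reach B {x0}" using that by (auto simp: cluster_def split: if_splits)
    then obtain F where F: "F \<subseteq> B" "finite F" "w \<in> reach F {x0}"
      using reach_finitary[OF w(2)] by blast
    then have "w \<in> cluster (F \<union> G)" by (simp add: cluster_def reach_gate)
    then show ?thesis using F w gate by (intro exI[of _ "F \<union> G"]) auto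
  qed
  show "cluster B \<subseteq> reach B {x0}" for B by (simp add: cluster_def)
  show "\<exists>a>0. \<forall>L. finite L \<longrightarrow> x0 \<in> L \<longrightarrow> (\<exists>J\<subseteq>I. finite J \<and> out_items L \<subseteq> J \<and>
      a * bexp J q (\<lambda>B. of_bool (x0 \<in> escape L B)) \<le> bexp J q (\<lambda>B. of_bool (\<not> cluster B \<subseteq> L)))"
    if "0 < q" "q \<le> 1" for q :: real
  proof (intro exI[of _ "q ^ card G"] conjI allI impI)
    fix L :: "'a set" assume "finite L" "x0 \<in> L"
    then show "\<exists>J\<subseteq>I. finite J \<and> out_items L \<subseteq> J \<and> q ^ card G * bexp J q (\<lambda>B. of_bool (x0 \<in> escape L B))
        \<le> bexp J q (\<lambda>B. of_bool (\<not> cluster B \<subseteq> L))"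
      using gate finite_out_items out_items_subset bexp_gate[of "G \<union> out_items L" q L]
      by (intro exI[of _ "G \<union> out_items L"]) auto
  qed (use that in auto)
qed

lemma Sup_no_percolation_le: "Sup no_percolation \<le> 1"
proof (rule cSup_least)
  show "no_percolation \<noteq> {}" using zero_no_percolation by blast
qed (simp add: no_percolation_def)

theorem expected_cluster_size_analytic:
  assumes "\<And>p. 0 \<le> p \<Longrightarrow> p < Sup no_percolation \<Longrightarrow>
    \<exists>c>0. eventually (\<lambda>n. tail p n \<le> exp (- (c * real n))) sequentially"
  shows "ennreal_analytic_on (\<lambda>p. \<integral>\<^sup>+ \<omega>. ennreal_of_enat (set_size (cluster (opened I \<omega>)))
    \<partial>percolation_law I p) {0..<Sup no_percolation}"
proof -
  obtain d where d: "\<And>A. finite A \<Longrightarrow> A \<subseteq> V \<Longrightarrow> card (out_items A) \<le> d * card A"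
    using card_out_items_le by blast
  \<comment> \<open>The extra unit in \<open>Suc d\<close> pays for the gate, since
    \<open>card G \<le> 1 \<le> card A\<close>.\<close>
  interpret local_cluster V I cluster "Suc d"
  proof
    fix A :: "'a set" assume A: "finite A" "A \<noteq> {}" "A \<subseteq> V"
    have "card A \<ge> 1" using A by (simp add: Suc_le_eq card_gt_0_iff)
    show "\<exists>J\<subseteq>I. finite J \<and> card J \<le> Suc d * card A \<and>
        (\<forall>B B'. B \<inter> J = B' \<inter> J \<longrightarrow> cluster B = A \<longrightarrow> cluster B' = A)"
    proof (intro exI[of _ "G \<union> out_items A"] conjI allI impI)
      show "card (G \<union> out_items A) \<le> Suc d * card A"
        using card_Un_le[of G "out_items A"] d[of A] A(1,3) gate(3) \<open>card A \<ge> 1\<close> by simp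
      show "cluster B' = A"
        if "B \<inter> (G \<union> out_items A) = B' \<inter> (G \<union> out_items A)" "cluster B = A" for B B'
        using cluster_determined[OF A(2) that] .
    qed (use gate finite_out_items[OF A(1)] out_items_subset[of A] in simp_all)
  qed (rule infinite_V)
  show ?thesis
    using Sup_no_percolation_le assms by (rule analytic_expected_size)
qed

end

section \<open>Verification of the two models and the conclusion\<close>

lemma bond_gated_item_graph:
  assumes "simple_graph V E" "countable V" "infinite V" "bounded_degree V E" "v \<in> V"
  shows "gated_item_graph V E E (\<lambda>x y. {x, y}) v {}"
proof -
  interpret item_graph V E E "\<lambda>x y. {x, y}"
    by unfold_locales (use assms in auto)
  have "E \<subseteq> (\<lambda>(x, y). {x, y}) ` (V \<times> V)"
    using assms(1) by (fastforce simp: simple_graph_def)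
  then have "countable E"
    using assms(2) by (meson countable_SIGMA countable_image countable_subset)
  then show ?thesis
    by unfold_locales (use assms in auto)
qed

lemma site_gated_item_graph:
  assumes "simple_graph V E" "countable V" "infinite V" "bounded_degree V E" "v \<in> V"
  shows "gated_item_graph V E V (\<lambda>x y. y) v {v}"
proof -
  have "y \<in> V" if "{x, y} \<in> E" for x y
    using assms(1) that by (fastforce simp: simple_graph_def doubleton_eq_iff)
  then interpret item_graph V E V "\<lambda>x y. y"
    by unfold_locales (use assms in auto)
  have reach: "reach (B \<union> {v}) {v} = reach B {v}" for B
  proof
    show "reach (B \<union> {v}) {v} \<subseteq> reach B {v}"
    proof
      fix w assume "w \<in> reach (B \<union> {v}) {v}"
      then have "(v, w) \<in> (arcs (B \<union> {v}))\<^sup>*" by (simp add: reach_def)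
      then show "w \<in> reach B {v}"
      proof (induction)
        case base
        then show ?case by (simp add: reach_def)
      next
        case (step w w')
        show ?case
        \<comment> \<open>The item \<open>v\<close> opens only arcs into \<open>v\<close>, and a
          path returning to its start can be cut there.\<close>
        proof (cases "w' = v")
          case True
          then show ?thesis by (simp add: reach_def)
        next
          case False
          then have "(w, w') \<in> arcs B" using step.hyps by (auto simp: arcs_def)
          then show ?thesis using step.IH reach_step by blast
        qed
      qed
    qed
  qed (rule reach_mono, auto)
  show ?thesis
    by unfold_locales (use assms reach in auto)
qed

lemma vertex_transitiveD:
  assumes "vertex_transitive V E" "u \<in> V" "y \<in> V"
  obtains f where "graph_automorphism V E f" "f u = y" "inj_on f V"
proof -
  obtain f where f: "graph_automorphism V E f" "f u = y"
    using assms unfolding vertex_transitive_def by blast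
  then have "inj_on f V" by (simp add: graph_automorphism_def bij_betw_def)
  with f show thesis by (rule that)
qed

theorem theorem4p11:
  fixes V :: "'a set" and E :: "'a set set" and v :: 'a
  assumes "simple_graph V E" and "connected_graph V E"
    and "countable V" and "infinite V" and "bounded_degree V E"
    and "v \<in> V"
  shows "((ANB_property V E (bond_cluster E) \<longrightarrow>
            ennreal_analytic_on (susceptibility E (bond_cluster E) v)
              {0..<critical_value E (bond_cluster E) v})
          \<and> (vertex_transitive V E \<longrightarrow> ANB_property V E (bond_cluster E)))
       \<and> ((ANB_property V V (site_cluster E) \<longrightarrow>
            ennreal_analytic_on (susceptibility V (site_cluster E) v)
              {0..<critical_value V (site_cluster E) v})
          \<and> (vertex_transitive V E \<longrightarrow> ANB_property V V (site_cluster E)))"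
proof (intro conjI impI)
  note graph = assms(1,3,4,5)
  have bond: "bond_cluster E u \<omega> = gated_item_graph.cluster E (\<lambda>x y. {x, y}) u {} (opened E \<omega>)"
    if "u \<in> V" for u \<omega>
  proof -
    interpret gated_item_graph V E E "\<lambda>x y. {x, y}" u "{}"
      using bond_gated_item_graph[OF graph that] .
    have "arcs (opened E \<omega>) = {(x, y). {x, y} \<in> E \<and> \<omega> {x, y}}"
      by (auto simp: arcs_def opened_def)
    then show ?thesis by (simp add: cluster_def reach_def bond_cluster_def Image_singleton)
  qed
  have site: "site_cluster E u \<omega> = gated_item_graph.cluster E (\<lambda>x y. y) u {u} (opened V \<omega>)"
    if u: "u \<in> V" for u \<omega>
  proof -
    interpret gated_item_graph V E V "\<lambda>x y. y" u "{u}"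
      using site_gated_item_graph[OF graph that] .
    let ?R = "{(x, y). {x, y} \<in> E \<and> \<omega> x \<and> \<omega> y}"
    have "(u, w) \<in> ?R\<^sup>*" if "\<omega> u" "(u, w) \<in> (arcs (opened V \<omega>))\<^sup>*" for w
    proof -
      \<comment> \<open>An open arc demands only an occupied head. Carrying
        \<open>\<omega> w\<close> along shows that the tail is occupied too: it is \<open>u\<close>
        or the head of the preceding arc.\<close>
      have "(u, w) \<in> ?R\<^sup>* \<and> \<omega> w" using that(2)
        by (induction)
          (use that(1) in \<open>auto simp: arcs_def opened_def intro: rtrancl_into_rtrancl\<close>)
      then show ?thesis ..
    qed
    moreover have "?R \<subseteq> arcs (opened V \<omega>)"
      using edge_V by (auto simp: arcs_def opened_def)
    then have "?R\<^sup>* \<subseteq> (arcs (opened V \<omega>))\<^sup>*" by (rule rtrancl_mono)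
    ultimately show ?thesis
      using u by (auto simp: cluster_def reach_def site_cluster_def opened_def)
  qed
  {
    interpret gated_item_graph V E E "\<lambda>x y. {x, y}" v "{}"
      using bond_gated_item_graph[OF graph assms(6)] .
    assume "ANB_property V E (bond_cluster E)"
    then show "ennreal_analytic_on (susceptibility E (bond_cluster E) v)
        {0..<critical_value E (bond_cluster E) v}"
      using expected_cluster_size_analytic assms(6)
      by (auto simp: ANB_property_def susceptibility_def[abs_def] critical_value_def bond[OF assms(6)]
          no_percolation_def tail_def)
  next
    interpret gated_item_graph V E V "\<lambda>x y. y" v "{v}"
      using site_gated_item_graph[OF graph assms(6)] .
    assume "ANB_property V V (site_cluster E)"
    then show "ennreal_analytic_on (susceptibility V (site_cluster E) v)
        {0..<critical_value V (site_cluster E) v}"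
      using expected_cluster_size_analytic assms(6)
      by (auto simp: ANB_property_def susceptibility_def[abs_def] critical_value_def site[OF assms(6)]
          no_percolation_def tail_def)
  next
    assume trans: "vertex_transitive V E"
    show "ANB_property V E (bond_cluster E)"
      unfolding ANB_property_def
    proof (intro ballI allI impI)
      fix u p assume u: "u \<in> V"
        and p: "0 \<le> p \<and> p < critical_value E (bond_cluster E) u"
      \<comment> \<open>The property concerns every vertex \<open>u\<close>, with the critical value
        computed at \<open>u\<close>, so the model is rooted at \<open>u\<close> instead of
        \<open>v\<close>.\<close>
      interpret gated_item_graph V E E "\<lambda>x y. {x, y}" u "{}"
        using bond_gated_item_graph[OF graph u] .
      have "items_transitive_from u"
        unfolding items_transitive_from_def
      proof
        fix y assume "y \<in> V"
        then obtain f where f: "graph_automorphism V E f" "f u = y" "inj_on f V"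
          using vertex_transitiveD[OF trans u] by blast
        have "E \<subseteq> Pow V" using assms(1) by (auto simp: simple_graph_def)
        then have "inj_on ((`) f) E"
          using inj_on_image_Pow[OF f(3)] inj_on_subset by blast
        then show "\<exists>f h. graph_automorphism V E f \<and> f u = y \<and> inj_on h E \<and>
            (\<forall>x x'. {x, x'} \<in> E \<longrightarrow> {f x, f x'} = h {x, x'})"
          using f by (intro exI[of _ f] exI[of _ "(`) f"]) auto
      qed
      then show "\<exists>c>0. eventually (\<lambda>n. measure (percolation_law E p)
          {\<omega> \<in> space (percolation_law E p). set_size (bond_cluster E u \<omega>) \<ge> enat n}
            \<le> exp (- (c * real n))) sequentially"
        using exponential_tail[of p] p
        by (simp add: critical_value_def no_percolation_def bond[OF u] tail_def)
    qed
  next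
    assume trans: "vertex_transitive V E"
    show "ANB_property V V (site_cluster E)"
      unfolding ANB_property_def
    proof (intro ballI allI impI)
      fix u p assume u: "u \<in> V"
        and p: "0 \<le> p \<and> p < critical_value V (site_cluster E) u"
      interpret gated_item_graph V E V "\<lambda>x y. y" u "{u}"
        using site_gated_item_graph[OF graph u] .
      have "items_transitive_from u"
        unfolding items_transitive_from_def
        using vertex_transitiveD[OF trans u] by metis
      then show "\<exists>c>0. eventually (\<lambda>n. measure (percolation_law V p)
          {\<omega> \<in> space (percolation_law V p). set_size (site_cluster E u \<omega>) \<ge> enat n}
            \<le> exp (- (c * real n))) sequentially"
        using exponential_tail[of p] p
        by (simp add: critical_value_def no_percolation_def site[OF u] tail_def)
    qed
  }
qed

end
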